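(* Let $f\colon D^*\to H^3$ be a regular WCF-end of a flat front with multiplicity $m$, ratio of Gauss maps $\alpha$, and top-term coefficient $q_{-2}$ of the Hopf differential. Then the eigenvalues of the flux matrix $\Phi_f$ are \[\pm\frac{2m\alpha}{(1-\alpha)^2}\quad\Big(=\mp\frac{2q_{-2}}{m}\Big).\] In particular, if $\alpha\neq0$ (that is, $f$ is not horospherical), then $\Phi_f$ is diagonalizable.
   Context: $H^3=\{uu^*:u\in SL(2,\mathbb{C})\}\subset\mathrm{Herm}(2)$, points regarded as matrices. Flat front on $D^*=\{0<|z|<1\}$: $f=\mathcal{E}\mathcal{E}^*$ with $\mathcal{E}=(E_{ij})$ a holomorphic immersion of the universal cover into $SL(2,\mathbb{C})$, $\mathcal{E}^{-1}d\mathcal{E}=\begin{pmatrix}0&\theta\\ \omega&0\end{pmatrix}$, $z$ compatible with $ds^2_{1,1}=|\omega|^2+|\theta|^2$. $G=E_{11}/E_{21}$, $G_*=E_{12}/E_{22}$ (hyperbolic Gauss maps), $Q=\omega\theta$ (Hopf differential). WCF-end: $ds^2_{1,1}$ complete at $0$ with finite total curvature near $0$; regular: $G,G_*$ have at most poles at $0$ (then $G(0)=G_*(0)$). For a regular WCF-end, $Q=z^{-2}(q_{-2}+o(1))dz^2$; horospherical means $q_{-2}=0$. Multiplicity $m$: with $G(0)\ne\infty$ (after an isometry), $m=\min\{\mathrm{ord}_0G',\mathrm{ord}_0G_*'\}+1$ (or ramification order of the nonconstant one if one is constant). $\alpha=(dG_*/dG)(0)$ if $|(dG_*/dG)(0)|\le1$,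 else $(dG/dG_* )(0)$; $\alpha\in[-1,1)$. Flux matrix: $\Phi_f=\frac{\mathrm{i}}{2\pi}\oint_\gamma(\partial f)f^{-1}$, $\gamma$ a loop around $0$ counterclockwise, $\partial f$ the $(1,0)$-part of $df$. *)

theory Defs
  imports "HOL-Complex_Analysis.Complex_Analysis"
begin

text \<open>The universal cover of D* = {0<|z|<1} is the left half plane, with covering map exp.\<close>
definition LH :: "complex set" where
  "LH = {w. Re w < 0}"

definition hconj :: "complex^2^2 \<Rightarrow> complex^2^2" where
  "hconj A = (\<chi> i j. cnj (A $ j $ i))"

definition mderiv :: "(complex \<Rightarrow> complex^2^2) \<Rightarrow> complex \<Rightarrow> complex^2^2" where
  "mderiv E w = (\<chi> i j. deriv (\<lambda>u. E u $ i $ j) w)"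

definition MC :: "(complex \<Rightarrow> complex^2^2) \<Rightarrow> complex \<Rightarrow> complex^2^2" where
  "MC E w = matrix_inv (E w) ** mderiv E w"

text \<open>theta = th_w dw and omega = om_w dw on the cover (coordinate w, z = exp w).\<close>
definition th_w :: "(complex \<Rightarrow> complex^2^2) \<Rightarrow> complex \<Rightarrow> complex" where
  "th_w E w = MC E w $ 1 $ 2"

definition om_w :: "(complex \<Rightarrow> complex^2^2) \<Rightarrow> complex \<Rightarrow> complex" where
  "om_w E w = MC E w $ 2 $ 1"

text \<open>E is the holomorphic (immersion) lift of a flat front f = E E^* defined on D*.\<close>
definition flat_front_lift :: "(complex \<Rightarrow> complex^2^2) \<Rightarrow> bool" where
  "flat_front_lift E \<longleftrightarrow>
     (\<forall>i j. (\<lambda>w. E w $ i $ j) holomorphic_on LH)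
   \<and> (\<forall>w\<in>LH. det (E w) = 1)
   \<and> (\<forall>w\<in>LH. mderiv E w \<noteq> 0)
   \<and> (\<forall>w\<in>LH. MC E w $ 1 $ 1 = 0 \<and> MC E w $ 2 $ 2 = 0)
   \<and> (\<forall>w\<in>LH. E (w + 2 * pi * \<i>) ** hconj (E (w + 2 * pi * \<i>)) = E w ** hconj (E w))"

text \<open>The front f : D* -> H^3, f = E E^*, as a function of z (well defined by periodicity).\<close>
definition front :: "(complex \<Rightarrow> complex^2^2) \<Rightarrow> complex \<Rightarrow> complex^2^2" where
  "front E z = E (Ln z) ** hconj (E (Ln z))"

section \<open>The metric ds^2_{1,1} = |omega|^2 + |theta|^2 = rho^2 |dw|^2 on the cover\<close>

definition rho_w :: "(complex \<Rightarrow> complex^2^2) \<Rightarrow> complex \<Rightarrow> real" where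
  "rho_w E w = sqrt ((cmod (om_w E w))\<^sup>2 + (cmod (th_w E w))\<^sup>2)"

definition dir2 :: "(complex \<Rightarrow> real) \<Rightarrow> complex \<Rightarrow> complex \<Rightarrow> real" where
  "dir2 u w v = deriv (\<lambda>s. deriv (\<lambda>r. u (w + of_real r * v)) s) 0"

definition laplacian :: "(complex \<Rightarrow> real) \<Rightarrow> complex \<Rightarrow> real" where
  "laplacian u w = dir2 u w 1 + dir2 u w \<i>"

definition gauss_curv :: "(complex \<Rightarrow> real) \<Rightarrow> complex \<Rightarrow> real" where
  "gauss_curv rho w = - laplacian (\<lambda>u. ln (rho u)) w / (rho w)\<^sup>2"

text \<open>Completeness at 0: every (piecewise C^1) curve in D* tending to 0 has infinite length;
  lifted to the cover, curves with Re w -> -infinity.\<close>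
definition complete_at_0 :: "(complex \<Rightarrow> complex^2^2) \<Rightarrow> bool" where
  "complete_at_0 E \<longleftrightarrow>
    (\<forall>\<gamma> :: real \<Rightarrow> complex.
       \<gamma> ` {0..<1} \<subseteq> LH
       \<longrightarrow> (\<forall>b\<in>{0..<1}. \<gamma> piecewise_C1_differentiable_on {0..b})
       \<longrightarrow> filterlim (\<lambda>s. Re (\<gamma> s)) at_bot (at_left 1)
       \<longrightarrow> (\<integral>\<^sup>+ s\<in>{0..<1}. ennreal (rho_w E (\<gamma> s) * norm (vector_derivative \<gamma> (at s))) \<partial>lborel) = \<infinity>)"

text \<open>Finite total curvature near 0: integral of |K| dA over a neighbourhood of the end
  (a fundamental domain of the cover over {0<|z|<e^R}) is finite.\<close>
definition finite_total_curvature_at_0 :: "(complex \<Rightarrow> complex^2^2) \<Rightarrow> bool" where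
  "finite_total_curvature_at_0 E \<longleftrightarrow>
    (\<exists>R<0. (\<integral>\<^sup>+ w\<in>{w. Re w < R \<and> 0 \<le> Im w \<and> Im w < 2 * pi}.
        ennreal (\<bar>gauss_curv (rho_w E) w\<bar> * (rho_w E w)\<^sup>2) \<partial>lborel) < \<infinity>)"

definition WCF_end :: "(complex \<Rightarrow> complex^2^2) \<Rightarrow> bool" where
  "WCF_end E \<longleftrightarrow> flat_front_lift E \<and> complete_at_0 E \<and> finite_total_curvature_at_0 E"

text \<open>Gz is the hyperbolic Gauss map G = E11/E21 as a (single valued) function of z on
  a punctured neighbourhood of 0, meromorphic at 0 (i.e. at most a pole at 0);
  the value infinity (E21 = 0) corresponds to a pole of Gz.\<close>
definition gauss_map_rep :: "(complex \<Rightarrow> complex^2^2) \<Rightarrow> 2 \<Rightarrow> (complex \<Rightarrow> complex) \<Rightarrow> bool" where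
  "gauss_map_rep E k Gz \<longleftrightarrow>
    (\<exists>e>0. e \<le> 1 \<and> Gz meromorphic_on ball 0 e
       \<and> (\<forall>w\<in>LH. exp w \<in> ball 0 e \<longrightarrow>
            (E w $ 2 $ k \<noteq> 0 \<longrightarrow> Gz (exp w) = E w $ 1 $ k / E w $ 2 $ k)
          \<and> (E w $ 2 $ k = 0 \<longrightarrow> is_pole Gz (exp w))))"

definition const_near_0 :: "(complex \<Rightarrow> complex) \<Rightarrow> bool" where
  "const_near_0 g \<longleftrightarrow> (\<exists>c. \<forall>\<^sub>F z in at 0. g z = c)"

definition multiplicity :: "(complex \<Rightarrow> complex) \<Rightarrow> (complex \<Rightarrow> complex) \<Rightarrow> int" where
  "multiplicity G Gs =
    (if const_near_0 G then zorder (deriv Gs) 0 + 1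
     else if const_near_0 Gs then zorder (deriv G) 0 + 1
     else min (zorder (deriv G) 0) (zorder (deriv Gs) 0) + 1)"

definition is_alpha :: "(complex \<Rightarrow> complex) \<Rightarrow> (complex \<Rightarrow> complex) \<Rightarrow> complex \<Rightarrow> bool" where
  "is_alpha G Gs a \<longleftrightarrow>
    (if (\<exists>c. ((\<lambda>z. deriv Gs z / deriv G z) \<longlongrightarrow> c) (at 0) \<and> cmod c \<le> 1)
     then ((\<lambda>z. deriv Gs z / deriv G z) \<longlongrightarrow> a) (at 0)
     else ((\<lambda>z. deriv G z / deriv Gs z) \<longlongrightarrow> a) (at 0))"

text \<open>Q = omega theta = om_w th_w dw^2 = z^{-2} (om_w th_w) dz^2, so
  Q = z^{-2}(q + o(1)) dz^2 iff om_w th_w -> q as Re w -> -infinity.\<close>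
definition hopf_top_coeff :: "(complex \<Rightarrow> complex^2^2) \<Rightarrow> complex \<Rightarrow> bool" where
  "hopf_top_coeff E q \<longleftrightarrow>
    (\<forall>\<epsilon>>0. \<exists>R<0. \<forall>w. Re w < R \<longrightarrow> cmod (om_w E w * th_w E w - q) < \<epsilon>)"

definition wirtinger :: "(complex \<Rightarrow> complex^2^2) \<Rightarrow> complex \<Rightarrow> complex^2^2" where
  "wirtinger F z = (\<chi> i j. (vector_derivative (\<lambda>t. F (z + of_real t)) (at 0) $ i $ j
                            - \<i> * vector_derivative (\<lambda>t. F (z + \<i> * of_real t)) (at 0) $ i $ j) / 2)"

definition flux :: "(complex \<Rightarrow> complex^2^2) \<Rightarrow> real \<Rightarrow> complex^2^2" where
  "flux f r = (\<chi> i j. \<i> / (2 * pi) *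
      contour_integral (circlepath 0 r) (\<lambda>z. (wirtinger f z ** matrix_inv (f z)) $ i $ j))"

definition is_eigenvalue :: "complex^2^2 \<Rightarrow> complex \<Rightarrow> bool" where
  "is_eigenvalue A c \<longleftrightarrow> (\<exists>v. v \<noteq> 0 \<and> A *v v = c *s v)"

definition diagonalizable :: "complex^2^2 \<Rightarrow> bool" where
  "diagonalizable A \<longleftrightarrow> (\<exists>P :: complex^2^2. invertible P \<and>
      (\<forall>i j. i \<noteq> j \<longrightarrow> (matrix_inv P ** A ** P) $ i $ j = 0))"

end

theory Submission
  imports Defs
begin

text \<open>
  On the cover \<open>(\<partial>f) f\<^sup>-\<^sup>1 = E' E\<^sup>-\<^sup>1 dw\<close>, so the flux matrix is minus the residue of this form at \<open>0\<close>.
  Writing \<open>E\<close> through its Gauss maps, \<open>E' E\<^sup>-\<^sup>1 dw\<close> becomes \<open>(G - Gs)\<^sup>-\<^sup>2 dz\<close> times the matrix with rows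
  \<open>(- (G' Gs + G Gs'), Gs\<^sup>2 G' + G\<^sup>2 Gs')\<close> and \<open>(- (G' + Gs'), G' Gs + G Gs')\<close>,
  and \<open>Q = - G' Gs' / (G - Gs)\<^sup>2 dz\<^sup>2\<close>.
  Completeness forces \<open>G 0 = Gs 0\<close>, and after an isometry the common value is \<open>0\<close>.  Then
  \<open>G = z\<^sup>m u\<close> and \<open>Gs = z\<^sup>m v\<close> with \<open>u 0\<close>, \<open>v 0\<close> not both zero, and \<open>u 0 \<noteq> v 0\<close> because
  \<open>Q\<close> has at most a double pole.  Hence the residue is lower triangular with diagonal entries
  \<open>\<mp> 2 m u 0 v 0 / (u 0 - v 0)\<^sup>2\<close>, where \<open>\<alpha>\<close> is \<open>v 0 / u 0\<close> or \<open>u 0 / v 0\<close>.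
\<close>

section \<open>Two-by-two matrices and the form $(\partial f)f^{-1}$\<close>

(* same infix as vec_nth: each occurrence doubles the number of parse trees *)
no_notation fps_nth (infixl \<open>$\<close> 75)

lemma matrix_inv_eqI:
  fixes A B :: "'a::semiring_1^'n^'n"
  assumes "A ** B = mat 1" "B ** A = mat 1"
  shows "matrix_inv A = B"
proof -
  have "A ** matrix_inv A = mat 1 \<and> matrix_inv A ** A = mat 1"
    unfolding matrix_inv_def by (rule someI[of _ B]) (use assms in auto)
  then show ?thesis
    using assms by (metis matrix_mul_assoc matrix_mul_lid matrix_mul_rid)
qed

lemma matrix_inv_2:
  fixes A :: "complex^2^2"
  assumes "det A = 1"
  shows "matrix_inv A $ 1 $ 1 = A $ 2 $ 2" "matrix_inv A $ 1 $ 2 = - A $ 1 $ 2"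
    "matrix_inv A $ 2 $ 1 = - A $ 2 $ 1" "matrix_inv A $ 2 $ 2 = A $ 1 $ 1"
proof -
  define B :: "complex^2^2" where "B = (\<chi> i j. if i = j then (if i = 1 then A $ 2 $ 2 else A $ 1 $ 1) else - A $ i $ j)"
  have "matrix_inv A = B"
    using assms
    by (intro matrix_inv_eqI)
      (auto simp: B_def vec_eq_iff forall_2 matrix_matrix_mult_def sum_2 mat_def det_2 algebra_simps)
  then show "matrix_inv A $ 1 $ 1 = A $ 2 $ 2" "matrix_inv A $ 1 $ 2 = - A $ 1 $ 2"
    "matrix_inv A $ 2 $ 1 = - A $ 2 $ 1" "matrix_inv A $ 2 $ 2 = A $ 1 $ 1"
    by (auto simp: B_def)
qed

lemma hconj_nth [simp]: "hconj A $ i $ j = cnj (A $ j $ i)"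
  by (simp add: hconj_def)

lemma det_hconj: "det (hconj A) = cnj (det A)"
  by (simp add: det_2 mult.commute)

lemma matrix_inv_2_mult:
  fixes A :: "complex^2^2"
  assumes "det A = 1"
  shows "A ** matrix_inv A = mat 1" "matrix_inv A ** A = mat 1"
proof -
  have "invertible A"
    using assms by (simp add: invertible_det_nz)
  then show "A ** matrix_inv A = mat 1" "matrix_inv A ** A = mat 1"
    unfolding invertible_def by (metis matrix_inv_eqI)+
qed

lemma matrix_inv_mult_2:
  fixes A B :: "complex^2^2"
  assumes "det A = 1" "det B = 1"
  shows "matrix_inv (A ** B) = matrix_inv B ** matrix_inv A"
proof (rule matrix_inv_eqI)
  show "A ** B ** (matrix_inv B ** matrix_inv A) = mat 1"
    by (metis assms matrix_inv_2_mult(1) matrix_mul_assoc matrix_mul_rid)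
  show "matrix_inv B ** matrix_inv A ** (A ** B) = mat 1"
    by (metis assms matrix_inv_2_mult(2) matrix_mul_assoc matrix_mul_rid)
qed

text \<open>For trace zero the characteristic polynomial is \<open>c\<^sup>2 + det A\<close>. The
  spectrum of the flux is thus governed by trace and determinant, which survive conjugation by an
  isometry.\<close>

lemma is_eigenvalue_trace_0_iff:
  fixes A :: "complex^2^2"
  assumes "A $ 1 $ 1 + A $ 2 $ 2 = 0" "det A = - \<mu>\<^sup>2"
  shows "is_eigenvalue A c \<longleftrightarrow> c = \<mu> \<or> c = - \<mu>"
proof -
  have "is_eigenvalue A c \<longleftrightarrow> (\<exists>v. v \<noteq> 0 \<and> (A - mat c) *v v = 0)"
    by (auto simp: is_eigenvalue_def vec_eq_iff forall_2 matrix_vector_mult_def sum_2 mat_def algebra_simps)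
  also have "\<dots> \<longleftrightarrow> det (A - mat c) = 0"
    by (metis invertible_det_nz invertible_left_inverse matrix_left_invertible_ker)
  also have "det (A - mat c) = c\<^sup>2 - \<mu>\<^sup>2"
    using assms by (simp add: det_2 mat_def algebra_simps power2_eq_square flip: distrib_left)
  also have "c\<^sup>2 - \<mu>\<^sup>2 = 0 \<longleftrightarrow> c = \<mu> \<or> c = - \<mu>"
    by (simp add: power2_eq_iff)
  finally show ?thesis .
qed

text \<open>The eigenvalues \<open>\<mu>\<close> and \<open>- \<mu>\<close> are distinct, so their
  eigenvectors are independent and serve as the columns of \<open>P\<close>.\<close>

lemma diagonalizable_trace_0:
  fixes A :: "complex^2^2"
  assumes tr: "A $ 1 $ 1 + A $ 2 $ 2 = 0" and det: "det A = - \<mu>\<^sup>2" and "\<mu> \<noteq> 0"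
  shows "diagonalizable A"
proof -
  obtain v w where v: "v \<noteq> 0" "A *v v = \<mu> *s v" and w: "w \<noteq> 0" "A *v w = (- \<mu>) *s w"
    using is_eigenvalue_trace_0_iff[OF tr det] unfolding is_eigenvalue_def by metis
  define P :: "complex^2^2" where "P = (\<chi> i j. if j = 1 then v $ i else w $ i)"
  define D :: "complex^2^2" where "D = (\<chi> i j. if i = j then (if i = 1 then \<mu> else - \<mu>) else 0)"
  have AP: "A ** P = P ** D"
    using v(2) w(2)
    by (auto simp: P_def D_def vec_eq_iff forall_2 matrix_matrix_mult_def matrix_vector_mult_def sum_2 mult.commute)
  have "x = 0" if "P *v x = 0" for x
  proof -
    have Px: "x $ 1 *s v + x $ 2 *s w = 0"
      using that by (simp add: P_def vec_eq_iff forall_2 matrix_vector_mult_def sum_2 mult.commute)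
    \<comment> \<open>Applying \<open>A\<close> to the vanishing sum flips the sign of its second
      term; with sum and difference both zero, each term is zero.\<close>
    have "A *v (x $ 1 *s v + x $ 2 *s w) = \<mu> *s (x $ 1 *s v - x $ 2 *s w)"
      by (simp add: matrix_vector_right_distrib vector_scalar_commute v(2) w(2) vec_eq_iff algebra_simps)
    then have "\<mu> *s (x $ 1 *s v - x $ 2 *s w) = 0"
      unfolding Px by simp
    then have "x $ 1 *s v - x $ 2 *s w = 0"
      using \<open>\<mu> \<noteq> 0\<close> unfolding vector_mul_eq_0 by simp
    with Px have "x $ 1 *s v = 0" "x $ 2 *s w = 0"
      by (auto simp: vec_eq_iff algebra_simps eq_neg_iff_add_eq_0)
    then show ?thesis
      using v(1) w(1) by (auto simp: vec_eq_iff forall_2)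
  qed
  then have "invertible P"
    by (simp add: invertible_left_inverse matrix_left_invertible_ker)
  then have "matrix_inv P ** P = mat 1"
    by (metis invertible_def matrix_inv_eqI)
  then have "matrix_inv P ** A ** P = D"
    by (metis AP matrix_mul_assoc matrix_mul_lid)
  then show ?thesis
    unfolding diagonalizable_def using \<open>invertible P\<close>
    by (intro exI[of _ P]) (auto simp: D_def)
qed

section \<open>The covering map and the front on the punctured disc\<close>

lemma exp_in_unit_disc_iff: "cmod (exp w) < 1 \<longleftrightarrow> w \<in> LH"
  by (simp add: LH_def)

lemma open_LH: "open LH"
  unfolding LH_def by (rule open_halfspace_Re_lt)

text \<open>\<open>front\<close> uses the principal logarithm. Any other logarithm of the same point
  differs from it by a multiple of the period, so the choice of preimage is immaterial.\<close>

lemma front_exp: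
  assumes E: "flat_front_lift E" and w: "w \<in> LH"
  shows "front E (exp w) = E w ** hconj (E w)"
proof -
  let ?f = "\<lambda>w. E w ** hconj (E w)"
  have per: "?f (w + 2 * pi * \<i>) = ?f w" if "w \<in> LH" for w
    using E that by (simp add: flat_front_lift_def)
  have nat: "?f (w + of_nat n * (2 * pi * \<i>)) = ?f w" if "w \<in> LH" for w n
  proof (induction n)
    case (Suc n)
    have "w + of_nat n * (2 * pi * \<i>) \<in> LH"
      using that by (simp add: LH_def)
    from per[OF this] Suc show ?case
      by (simp add: algebra_simps)
  qed simp
  obtain n :: int where n: "Ln (exp w) = w + of_int n * (2 * pi * \<i>)"
  proof -
    have "exp (Ln (exp w)) = exp w" by simp
    then obtain n :: int where "Ln (exp w) = w + (of_int (2 * n) * pi) * \<i>"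
      unfolding exp_eq by blast
    then show ?thesis by (intro that[of n]) (simp add: algebra_simps)
  qed
  show ?thesis
  proof (cases "n \<ge> 0")
    case True
    then show ?thesis
      using nat[OF w, of "nat n"] by (simp add: front_def n)
  next
    case False
    \<comment> \<open>For negative \<open>n\<close> the upward shifts start at
      \<open>Ln (exp w)\<close> and end at \<open>w\<close>.\<close>
    have "Ln (exp w) \<in> LH"
      using w by (simp add: n LH_def)
    from nat[OF this, of "nat (- n)"] show ?thesis
      using False by (simp add: front_def n)
  qed
qed

lemma has_vector_derivative_vec:
  fixes f :: "real \<Rightarrow> 'a::euclidean_space^'n"
  assumes "\<And>i. ((\<lambda>x. f x $ i) has_vector_derivative D $ i) F"
  shows "(f has_vector_derivative D) F"
proof -
  have *: "x = (\<Sum>i\<in>UNIV. axis i (x $ i))" for x :: "'a^'n"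
    by (simp add: vec_eq_iff axis_def)
  have lin: "bounded_linear (axis i :: 'a \<Rightarrow> 'a^'n)" for i
    unfolding linear_conv_bounded_linear[symmetric] by (rule linearI) (auto simp: axis_def vec_eq_iff)
  have "((\<lambda>x. axis i (f x $ i)) has_vector_derivative axis i (D $ i)) F" for i
    by (rule bounded_linear.has_vector_derivative[OF lin assms])
  then have "((\<lambda>x. \<Sum>i\<in>UNIV. axis i (f x $ i)) has_vector_derivative (\<Sum>i\<in>UNIV. axis i (D $ i))) F"
    by (rule has_vector_derivative_sum)
  then show ?thesis
    unfolding *[symmetric] .
qed

text \<open>\<open>E\<close> is holomorphic and \<open>hconj\<close> of it antiholomorphic, so the
  (1,0)-derivative falls on the first factor alone. The division by \<open>exp w\<close> is the
  chain rule for \<open>dw = dz / z\<close>.\<close>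

lemma wirtinger_front:
  assumes E: "flat_front_lift E" and w: "w \<in> LH"
  shows "wirtinger (front E) (exp w) $ i $ j = (mderiv E w ** hconj (E w)) $ i $ j / exp w"
proof -
  define z0 where "z0 = exp w"
  have z0: "z0 \<noteq> 0" by (simp add: z0_def)
  \<comment> \<open>\<open>L\<close> is the branch of the logarithm near \<open>z0\<close> that
    takes the value \<open>w\<close> there; dividing by \<open>z0\<close> keeps the argument of
    \<open>Ln\<close> near 1, away from the cut.\<close>
  define L where "L z = w + Ln (z / z0)" for z
  define U where "U = {z. Re (z / z0) > 0} \<inter> ball 0 1 - {0}"
  have "open {z. Re (z / z0) > 0}"
    by (intro open_Collect_less continuous_intros) (use z0 in auto)
  then have U: "open U" "z0 \<in> U"
    using w z0 exp_in_unit_disc_iff[of w] by (auto simp: U_def z0_def)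
  have expL: "exp (L z) = z" if "z \<noteq> 0" for z
    using that z0 by (simp add: L_def exp_add z0_def)
  have frontU: "front E z = E (L z) ** hconj (E (L z))" if "z \<in> U" for z
  proof -
    have "z \<noteq> 0" "cmod z < 1" using that by (auto simp: U_def)
    then have "L z \<in> LH"
      by (metis expL exp_in_unit_disc_iff)
    from front_exp[OF E this] show ?thesis
      using expL \<open>z \<noteq> 0\<close> by simp
  qed
  have L0: "L z0 = w" using z0 by (simp add: L_def)
  have dL: "(L has_field_derivative 1 / z0) (at z0)"
    unfolding L_def using z0
    by (auto intro!: derivative_eq_intros simp: field_simps)
  define e where "e i k z = E (L z) $ i $ k" for i k z
  have de: "(e i k has_field_derivative mderiv E w $ i $ k / z0) (at z0)" for i k
  proof -
    have "((\<lambda>u. E u $ i $ k) has_field_derivative mderiv E w $ i $ k) (at (L z0))"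
      using E w open_LH unfolding L0 flat_front_lift_def mderiv_def
      by (auto intro: holomorphic_derivI)
    from DERIV_chain2[OF this dL] show ?thesis
      by (simp add: e_def[abs_def])
  qed
  \<comment> \<open>Along a line with direction \<open>c\<close>, the holomorphic factor contributes
    \<open>c\<close> and the conjugated factor contributes \<open>cnj c\<close>.\<close>
  have der: "vector_derivative (\<lambda>t. front E (z0 + c * of_real t)) (at 0) $ i $ j =
     (\<Sum>k\<in>UNIV. c * mderiv E w $ i $ k / z0 * cnj (E w $ j $ k)
        + E w $ i $ k * cnj (c * mderiv E w $ j $ k / z0))" for c i j
  proof -
    define D :: "complex^2^2" where "D = (\<chi> i j. \<Sum>k\<in>UNIV. c * mderiv E w $ i $ k / z0 * cnj (E w $ j $ k)
        + E w $ i $ k * cnj (c * mderiv E w $ j $ k / z0))"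
    have line: "((\<lambda>t. z0 + c * of_real t) has_vector_derivative c) (at 0)"
      by (auto intro!: derivative_eq_intros)
    have dec: "((\<lambda>t. e i k (z0 + c * of_real t)) has_vector_derivative c * mderiv E w $ i $ k / z0) (at 0)" for i k
      using field_vector_diff_chain_at[OF line, of "e i k" "mderiv E w $ i $ k / z0"] de[of i k] by (simp add: o_def)
    have prod: "((\<lambda>t. e i k (z0 + c * of_real t) * cnj (e j k (z0 + c * of_real t))) has_vector_derivative
       c * mderiv E w $ i $ k / z0 * cnj (E w $ j $ k) + E w $ i $ k * cnj (c * mderiv E w $ j $ k / z0)) (at 0)" for i j k
      using has_vector_derivative_mult[OF dec[of i k] has_vector_derivative_cnj[OF dec[of j k]]]
      by (simp add: e_def L0 add.commute)
    have "((\<lambda>t. E (L (z0 + c * of_real t)) ** hconj (E (L (z0 + c * of_real t)))) has_vector_derivative D) (at 0)"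
      unfolding D_def matrix_matrix_mult_def
      by (intro has_vector_derivative_vec)
         (simp only: vec_lambda_beta hconj_nth, intro has_vector_derivative_sum prod[unfolded e_def])
    moreover have "open {t. z0 + c * of_real t \<in> U}" 
      using continuous_open_vimage[OF U(1), of "\<lambda>t::real. z0 + c * of_real t"]
      by (simp add: vimage_def)
    ultimately have "((\<lambda>t. front E (z0 + c * of_real t)) has_vector_derivative D) (at 0)"
      by (rule has_vector_derivative_transform_within_open) (use U in \<open>auto simp: frontU\<close>)
    then show ?thesis
      by (simp add: vector_derivative_at D_def)
  qed
  \<comment> \<open>\<open>X\<close> and \<open>Y\<close> are the (1,0)- and (0,1)-parts. The
    directions 1 and \<open>\<i>\<close> give \<open>X + Y\<close> and
    \<open>\<i> * X - \<i> * Y\<close>, from which the Wirtinger combination isolates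
    \<open>X\<close>.\<close>
  define X where "X = (\<Sum>k\<in>UNIV. mderiv E w $ i $ k / z0 * cnj (E w $ j $ k))"
  define Y where "Y = (\<Sum>k\<in>UNIV. E w $ i $ k * cnj (mderiv E w $ j $ k / z0))"
  have "vector_derivative (\<lambda>t. front E (z0 + of_real t)) (at 0) $ i $ j = X + Y"
    using der[of 1 i j] by (simp add: X_def Y_def sum.distrib)
  moreover have "vector_derivative (\<lambda>t. front E (z0 + \<i> * of_real t)) (at 0) $ i $ j = \<i> * X - \<i> * Y"
    using der[of \<i> i j] by (simp add: X_def Y_def sum_subtractf sum_distrib_left mult_ac)
  moreover have "X = (mderiv E w ** hconj (E w)) $ i $ j / z0"
    by (simp add: X_def matrix_matrix_mult_def sum_2 add_divide_distrib)
  moreover have "(X + Y - \<i> * (\<i> * X - \<i> * Y)) / 2 = X"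
    by (simp add: algebra_simps)
  ultimately show ?thesis
    unfolding wirtinger_def z0_def[symmetric] by simp
qed

text \<open>The form $(\partial f)f^{-1}$ of the front, on the cover.\<close>
definition log_mderiv :: "(complex \<Rightarrow> complex^2^2) \<Rightarrow> complex \<Rightarrow> complex^2^2" where
  "log_mderiv E w = mderiv E w ** matrix_inv (E w)"

text \<open>The factor \<open>hconj (E w)\<close> of the (1,0)-derivative cancels against its
  inverse inside the inverse of the front.\<close>

lemma wirtinger_front_mult_inv:
  assumes E: "flat_front_lift E" and w: "w \<in> LH"
  shows "(wirtinger (front E) (exp w) ** matrix_inv (front E (exp w))) $ i $ j = log_mderiv E w $ i $ j / exp w"
proof -
  have det: "det (E w) = 1" "det (hconj (E w)) = 1"
    using E w by (auto simp: flat_front_lift_def det_hconj)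
  define N where "N = mderiv E w ** hconj (E w)"
  define M where "M = matrix_inv (hconj (E w)) ** matrix_inv (E w)"
  have "matrix_inv (front E (exp w)) = M"
    by (simp add: M_def front_exp[OF E w] matrix_inv_mult_2 det)
  then have "(wirtinger (front E) (exp w) ** matrix_inv (front E (exp w))) $ i $ j = (N ** M) $ i $ j / exp w"
    by (simp add: matrix_matrix_mult_def sum_2 wirtinger_front[OF E w, folded N_def] add_divide_distrib)
  also have "N ** M = log_mderiv E w"
    unfolding N_def M_def log_mderiv_def
    by (metis det(2) matrix_inv_2_mult(1) matrix_mul_assoc matrix_mul_rid)
  finally show ?thesis .
qed

text \<open>Locally \<open>g\<close> is \<open>h\<close> composed with a branch of the logarithm.
  This yields holomorphy of the flux integrand, which is defined through real derivatives
  only.\<close>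

lemma holomorphic_on_punctured_disc_if_lift:
  assumes h: "h holomorphic_on LH" and g: "\<And>w. w \<in> LH \<Longrightarrow> g (exp w) = h w"
  shows "g holomorphic_on ball 0 1 - {0}"
proof -
  have "g field_differentiable at z0" if z0: "z0 \<in> ball 0 1 - {0}" for z0
  proof -
    define w where "w = Ln z0"
    have w: "exp w = z0" "w \<in> LH" using z0 exp_in_unit_disc_iff[of w] by (auto simp: w_def)
    define L where "L z = w + Ln (z / z0)" for z
    have "(h \<circ> L) field_differentiable at z0"
    proof (rule field_differentiable_compose)
      show "L field_differentiable at z0"
        unfolding L_def using z0 by (intro analytic_on_imp_differentiable_at[of _ "{z0}"] analytic_intros) auto
      show "h field_differentiable at (L z0)"
        using h w z0 open_LH by (auto simp: L_def holomorphic_on_open field_differentiable_def)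
    qed
    then obtain D where D: "((h \<circ> L) has_field_derivative D) (at z0)"
      unfolding field_differentiable_def by blast
    have "\<forall>\<^sub>F z in nhds z0. z \<in> ball 0 1 - {0}"
      using z0 by (intro eventually_nhds_in_open) auto
    then have "\<forall>\<^sub>F z in nhds z0. (h \<circ> L) z = g z"
    proof eventually_elim
      case (elim z)
      then have "exp (L z) = z" using w z0 by (simp add: L_def exp_add)
      with elim g[of "L z"] exp_in_unit_disc_iff[of "L z"] show ?case by auto
    qed
    from DERIV_cong_ev[OF refl this refl] D show ?thesis
      unfolding field_differentiable_def by blast
  qed
  then show ?thesis
    by (simp add: holomorphic_on_def field_differentiable_at_within)
qed

section \<open>Gauss maps in terms of the lift\<close>

lemma MC_nth:
  assumes "det (F w) = 1"
  shows "MC F w $ 1 $ 1 = F w $ 2 $ 2 * mderiv F w $ 1 $ 1 - F w $ 1 $ 2 * mderiv F w $ 2 $ 1"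
    "MC F w $ 1 $ 2 = F w $ 2 $ 2 * mderiv F w $ 1 $ 2 - F w $ 1 $ 2 * mderiv F w $ 2 $ 2"
    "MC F w $ 2 $ 1 = F w $ 1 $ 1 * mderiv F w $ 2 $ 1 - F w $ 2 $ 1 * mderiv F w $ 1 $ 1"
    "MC F w $ 2 $ 2 = F w $ 1 $ 1 * mderiv F w $ 2 $ 2 - F w $ 2 $ 1 * mderiv F w $ 1 $ 2"
  using matrix_inv_2[OF assms] by (simp_all add: MC_def matrix_matrix_mult_def sum_2)

lemma log_mderiv_nth:
  assumes "det (F w) = 1"
  shows "log_mderiv F w $ 1 $ 1 = mderiv F w $ 1 $ 1 * F w $ 2 $ 2 - mderiv F w $ 1 $ 2 * F w $ 2 $ 1"
    "log_mderiv F w $ 1 $ 2 = mderiv F w $ 1 $ 2 * F w $ 1 $ 1 - mderiv F w $ 1 $ 1 * F w $ 1 $ 2"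
    "log_mderiv F w $ 2 $ 1 = mderiv F w $ 2 $ 1 * F w $ 2 $ 2 - mderiv F w $ 2 $ 2 * F w $ 2 $ 1"
    "log_mderiv F w $ 2 $ 2 = mderiv F w $ 2 $ 2 * F w $ 1 $ 1 - mderiv F w $ 2 $ 1 * F w $ 1 $ 2"
  using matrix_inv_2[OF assms] by (simp_all add: log_mderiv_def matrix_matrix_mult_def sum_2)

lemma mderiv_mult_left:
  fixes E :: "complex \<Rightarrow> complex^2^2"
  assumes "\<And>i j. (\<lambda>w. E w $ i $ j) field_differentiable at w"
  shows "mderiv (\<lambda>w. a ** E w) w = a ** mderiv E w"
proof -
  have "deriv (\<lambda>u. (a ** E u) $ i $ j) w = (a ** mderiv E w) $ i $ j" for i j
  proof (rule DERIV_imp_deriv)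
    have "((\<lambda>u. E u $ k $ j) has_field_derivative mderiv E w $ k $ j) (at w)" for k
      using assms by (simp add: mderiv_def field_differentiable_derivI)
    then show "((\<lambda>u. (a ** E u) $ i $ j) has_field_derivative (a ** mderiv E w) $ i $ j) (at w)"
      unfolding matrix_matrix_mult_def
      by (auto intro!: derivative_eq_intros simp: sum_2)
  qed
  then show ?thesis
    by (simp add: mderiv_def vec_eq_iff)
qed

text \<open>A constant left factor is an isometry of the front. It cancels here, so
  \<open>\<omega>\<close>, \<open>\<theta>\<close>, the metric and the Hopf differential are
  unchanged.\<close>

lemma MC_mult_left:
  fixes E :: "complex \<Rightarrow> complex^2^2"
  assumes "\<And>i j. (\<lambda>w. E w $ i $ j) field_differentiable at w" "det a = 1" "det (E w) = 1"
  shows "MC (\<lambda>w. a ** E w) w = MC E w"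
proof -
  have "MC (\<lambda>w. a ** E w) w = matrix_inv (E w) ** (matrix_inv a ** a) ** mderiv E w"
    by (simp add: MC_def mderiv_mult_left[OF assms(1)] matrix_inv_mult_2 assms matrix_mul_assoc)
  then show ?thesis
    by (simp add: MC_def matrix_inv_2_mult assms matrix_mul_rid)
qed

text \<open>In contrast to \<open>MC\<close>, this form is conjugated by the isometry, which is
  enough for trace and determinant.\<close>

lemma log_mderiv_mult_left:
  fixes E :: "complex \<Rightarrow> complex^2^2"
  assumes "\<And>i j. (\<lambda>w. E w $ i $ j) field_differentiable at w" "det a = 1" "det (E w) = 1"
  shows "log_mderiv (\<lambda>w. a ** E w) w = a ** log_mderiv E w ** matrix_inv a"
  by (simp add: log_mderiv_def mderiv_mult_left[OF assms(1)] matrix_inv_mult_2 assms matrix_mul_assoc)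

text \<open>The normalised situation near the end: both Gauss maps are finite and holomorphic on a
  punctured disc. The lift is called \<open>F\<close> because the results are applied to an
  isometric copy of \<open>E\<close>.\<close>

locale gauss_chart =
  fixes F :: "complex \<Rightarrow> complex^2^2" and G Gs :: "complex \<Rightarrow> complex" and e :: real
  assumes holF: "\<And>i j. (\<lambda>w. F w $ i $ j) holomorphic_on LH"
    and detF: "\<And>w. w \<in> LH \<Longrightarrow> det (F w) = 1"
    and MC_diag: "\<And>w. w \<in> LH \<Longrightarrow> MC F w $ 1 $ 1 = 0" "\<And>w. w \<in> LH \<Longrightarrow> MC F w $ 2 $ 2 = 0"
    and e: "0 < e" "e \<le> 1"
    and holG: "G holomorphic_on ball 0 e - {0}" "Gs holomorphic_on ball 0 e - {0}"
    and nz: "\<And>w. cmod (exp w) < e \<Longrightarrow> F w $ 2 $ 1 \<noteq> 0" "\<And>w. cmod (exp w) < e \<Longrightarrow> F w $ 2 $ 2 \<noteq> 0"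
    and G_eq: "\<And>w. cmod (exp w) < e \<Longrightarrow> G (exp w) = F w $ 1 $ 1 / F w $ 2 $ 1"
    and Gs_eq: "\<And>w. cmod (exp w) < e \<Longrightarrow> Gs (exp w) = F w $ 1 $ 2 / F w $ 2 $ 2"
begin

lemma in_LH: "cmod (exp w) < e \<Longrightarrow> w \<in> LH"
  using e exp_in_unit_disc_iff[of w] by linarith

lemma F_deriv:
  assumes "w \<in> LH"
  shows "((\<lambda>w. F w $ i $ j) has_field_derivative mderiv F w $ i $ j) (at w)"
  using assms holF open_LH by (auto simp: mderiv_def intro: holomorphic_derivI)

context
  fixes w z :: complex
  assumes w: "cmod (exp w) < e" and z: "z = exp w"
begin

lemma z_in: "z \<in> ball 0 e - {0}"
  using w z by auto

lemma det_eq: "F w $ 1 $ 1 * F w $ 2 $ 2 - F w $ 1 $ 2 * F w $ 2 $ 1 = 1"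
  using detF[OF in_LH[OF w]] by (simp add: det_2)

lemma MC_eqs:
  "F w $ 2 $ 2 * mderiv F w $ 1 $ 1 = F w $ 1 $ 2 * mderiv F w $ 2 $ 1"
  "F w $ 1 $ 1 * mderiv F w $ 2 $ 2 = F w $ 2 $ 1 * mderiv F w $ 1 $ 2"
  using MC_diag[OF in_LH[OF w]] MC_nth[of F w, OF detF[OF in_LH[OF w]]] by auto

text \<open>Over a common denominator the numerator is \<open>det (F w) = 1\<close>. This identity
  lets the entries of \<open>F\<close> be eliminated in favour of the Gauss maps.\<close>

lemma diff_eq: "G z - Gs z = 1 / (F w $ 2 $ 1 * F w $ 2 $ 2)"
  using nz[OF w] det_eq by (simp add: z G_eq[OF w] Gs_eq[OF w] field_simps)

text \<open>Quotient rule on the cover, with \<open>z * deriv\<close> on the disc corresponding to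
  the derivative in \<open>w\<close>.\<close>

lemma deriv_eqs:
  "z * deriv G z * (F w $ 2 $ 1)\<^sup>2 = mderiv F w $ 1 $ 1 * F w $ 2 $ 1 - F w $ 1 $ 1 * mderiv F w $ 2 $ 1"
  "z * deriv Gs z * (F w $ 2 $ 2)\<^sup>2 = mderiv F w $ 1 $ 2 * F w $ 2 $ 2 - F w $ 1 $ 2 * mderiv F w $ 2 $ 2"
proof -
  have ev: "\<forall>\<^sub>F v in nhds w. cmod (exp v) < e"
    using w eventually_nhds_in_open[of "{v. cmod (exp v) < e}" w]
    by (simp add: open_Collect_less continuous_intros)
  have chain: "z * deriv g z = (mderiv F w $ 1 $ k * F w $ 2 $ k - F w $ 1 $ k * mderiv F w $ 2 $ k) / (F w $ 2 $ k)\<^sup>2"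
    if g: "g holomorphic_on ball 0 e - {0}" and eq: "\<And>v. cmod (exp v) < e \<Longrightarrow> g (exp v) = F v $ 1 $ k / F v $ 2 $ k"
      and nz: "F w $ 2 $ k \<noteq> 0" for g k
  proof -
    have "open (ball 0 e - {0::complex})" by auto
    then have "(g has_field_derivative deriv g z) (at (exp w))"
      using g z_in unfolding z by (metis holomorphic_derivI)
    from DERIV_chain2[OF this DERIV_exp] have d1: "((\<lambda>v. g (exp v)) has_field_derivative deriv g z * z) (at w)"
      by (simp add: z)
    have d2: "((\<lambda>v. F v $ 1 $ k / F v $ 2 $ k) has_field_derivative
        (mderiv F w $ 1 $ k * F w $ 2 $ k - F w $ 1 $ k * mderiv F w $ 2 $ k) / (F w $ 2 $ k)\<^sup>2) (at w)"
      using DERIV_divide[OF F_deriv[OF in_LH[OF w]] F_deriv[OF in_LH[OF w]] nz] by (simp add: power2_eq_square)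
    have "\<forall>\<^sub>F v in nhds w. g (exp v) = F v $ 1 $ k / F v $ 2 $ k"
      using ev by eventually_elim (rule eq)
    from DERIV_cong_ev[OF refl this refl] d1
    have "((\<lambda>v. F v $ 1 $ k / F v $ 2 $ k) has_field_derivative deriv g z * z) (at w)"
      by blast
    from DERIV_unique[OF this d2]
    have "deriv g z * z = (mderiv F w $ 1 $ k * F w $ 2 $ k - F w $ 1 $ k * mderiv F w $ 2 $ k) / (F w $ 2 $ k)\<^sup>2" .
    then show ?thesis
      by (simp add: mult.commute)
  qed
  show "z * deriv G z * (F w $ 2 $ 1)\<^sup>2 = mderiv F w $ 1 $ 1 * F w $ 2 $ 1 - F w $ 1 $ 1 * mderiv F w $ 2 $ 1"
    using chain[OF holG(1) G_eq] nz[OF w] by simp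
  show "z * deriv Gs z * (F w $ 2 $ 2)\<^sup>2 = mderiv F w $ 1 $ 2 * F w $ 2 $ 2 - F w $ 1 $ 2 * mderiv F w $ 2 $ 2"
    using chain[OF holG(2) Gs_eq] nz[OF w] by simp
qed

lemma diff_nonzero: "G z \<noteq> Gs z"
  using diff_eq nz[OF w] by auto

lemma om_w_eq: "om_w F w = - (z * deriv G z * (F w $ 2 $ 1)\<^sup>2)"
  and th_w_eq: "th_w F w = z * deriv Gs z * (F w $ 2 $ 2)\<^sup>2"
  unfolding om_w_def th_w_def deriv_eqs MC_nth[of F w, OF detF[OF in_LH[OF w]]] by simp_all

lemma hopf_eq: "om_w F w * th_w F w = - (z\<^sup>2 * deriv G z * deriv Gs z / (G z - Gs z)\<^sup>2)"
  unfolding om_w_eq th_w_eq diff_eq by (simp add: power2_eq_square field_simps)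

text \<open>A linear differential equation, d log F21 = - dG / (G - Gs): the lift is recovered from
  its Gauss maps by one integration.\<close>

lemma mderiv_F21: "mderiv F w $ 2 $ 1 = - (z * deriv G z / (G z - Gs z)) * F w $ 2 $ 1"
proof -
  define p q s t dp ds where defs: "p = F w $ 1 $ 1" "q = F w $ 1 $ 2" "s = F w $ 2 $ 1" "t = F w $ 2 $ 2"
    "dp = mderiv F w $ 1 $ 1" "ds = mderiv F w $ 2 $ 1"
  have "- (z * deriv G z / (G z - Gs z)) * s = - (z * deriv G z * s\<^sup>2) * t"
    unfolding diff_eq defs by (simp add: power2_eq_square)
  also have "\<dots> = - (dp * s - p * ds) * t"
    unfolding defs deriv_eqs ..
  \<comment> \<open>The bracket split off here is a diagonal entry of \<open>MC\<close>, hence zero;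
    what remains is the determinant times \<open>ds\<close>.\<close>
  also have "\<dots> = (p * t - q * s) * ds - s * (t * dp - q * ds)"
    by (simp add: algebra_simps)
  also have "\<dots> = ds"
    using MC_eqs det_eq by (simp add: defs)
  finally show ?thesis
    by (simp add: defs)
qed

text \<open>Replacing \<open>1 / (G z - Gs z)\<^sup>2\<close> by \<open>(s * t)\<^sup>2\<close>
  makes both sides polynomial in the entries of \<open>F\<close> and of its derivative. They then
  agree modulo \<open>det = 1\<close> and the two vanishing diagonal entries of
  \<open>MC\<close>.\<close>

lemma log_mderiv_eqs:
  "log_mderiv F w $ 1 $ 1 = - z * (deriv G z * Gs z + G z * deriv Gs z) / (G z - Gs z)\<^sup>2"
  "log_mderiv F w $ 1 $ 2 = z * ((Gs z)\<^sup>2 * deriv G z + (G z)\<^sup>2 * deriv Gs z) / (G z - Gs z)\<^sup>2"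
  "log_mderiv F w $ 2 $ 2 = - log_mderiv F w $ 1 $ 1"
proof -
  define p q s t where defs1: "p = F w $ 1 $ 1" "q = F w $ 1 $ 2" "s = F w $ 2 $ 1" "t = F w $ 2 $ 2"
  define dp dq ds dt where defs2: "dp = mderiv F w $ 1 $ 1" "dq = mderiv F w $ 1 $ 2"
    "ds = mderiv F w $ 2 $ 1" "dt = mderiv F w $ 2 $ 2"
  note defs = defs1 defs2
  have G: "G z * s = p" "Gs z * t = q"
    using nz[OF w] by (auto simp: defs z G_eq[OF w] Gs_eq[OF w])
  have inv: "x / (G z - Gs z)\<^sup>2 = x * (s * t)\<^sup>2" for x
    unfolding diff_eq defs by (simp add: power2_eq_square)
  note d = deriv_eqs[folded defs] and det = det_eq[folded defs]
  have MC: "t * dp - q * ds = 0" "p * dt - s * dq = 0"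
    using MC_eqs by (simp_all add: defs)
  note nth = log_mderiv_nth[of F w, OF detF[OF in_LH[OF w]], folded defs]
  have "- z * (deriv G z * Gs z + G z * deriv Gs z) / (G z - Gs z)\<^sup>2
      = - ((z * deriv G z * s\<^sup>2) * (Gs z * t) * t + (G z * s) * s * (z * deriv Gs z * t\<^sup>2))"
    unfolding inv by (simp add: algebra_simps power2_eq_square)
  also have "\<dots> = (p * t - q * s) * (dp * t - dq * s) - p * t * (t * dp - q * ds) + s * q * (p * dt - s * dq)"
    unfolding d G by (simp add: algebra_simps)
  also have "\<dots> = log_mderiv F w $ 1 $ 1"
    unfolding nth MC det by simp
  finally show "log_mderiv F w $ 1 $ 1 = - z * (deriv G z * Gs z + G z * deriv Gs z) / (G z - Gs z)\<^sup>2" ..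
  have "z * ((Gs z)\<^sup>2 * deriv G z + (G z)\<^sup>2 * deriv Gs z) / (G z - Gs z)\<^sup>2
      = (Gs z * t)\<^sup>2 * (z * deriv G z * s\<^sup>2) + (G z * s)\<^sup>2 * (z * deriv Gs z * t\<^sup>2)"
    unfolding inv by (simp add: algebra_simps power2_eq_square)
  also have "\<dots> = (p * t - q * s) * (dq * p - dp * q) + p * q * (t * dp - q * ds) - p * q * (p * dt - s * dq)"
    unfolding d G by (simp add: algebra_simps power2_eq_square)
  also have "\<dots> = log_mderiv F w $ 1 $ 2"
    unfolding nth MC det by simp
  finally show "log_mderiv F w $ 1 $ 2 = z * ((Gs z)\<^sup>2 * deriv G z + (G z)\<^sup>2 * deriv Gs z) / (G z - Gs z)\<^sup>2" ..
  show "log_mderiv F w $ 2 $ 2 = - log_mderiv F w $ 1 $ 1"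
    unfolding nth using MC by (simp add: algebra_simps)
qed

end

end

section \<open>Completeness and the common value of the Gauss maps\<close>

context gauss_chart
begin

lemma diff_nonzero': "z \<in> ball 0 e - {0} \<Longrightarrow> G z \<noteq> Gs z"
  using diff_nonzero[of "Ln z" z] by auto

text \<open>If \<open>G\<close> and \<open>Gs\<close> had different values at \<open>0\<close>, then \<open>\<omega>\<close> and \<open>\<theta>\<close> would extend
  holomorphically to \<open>0\<close> and a radial path would reach the end with finite length.\<close>
lemma Gs_tendsto_0:
  assumes complete: "complete_at_0 F" and G0: "G \<midarrow>0\<rightarrow> 0" and ness: "not_essential Gs 0"
  shows "Gs \<midarrow>0\<rightarrow> 0"
proof (rule ccontr)
  assume no_lim: "\<not> Gs \<midarrow>0\<rightarrow> 0"
  \<comment> \<open>By \<open>diff_eq\<close> this is the product of the second-row entries of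
    \<open>F\<close>. It has a finite limit whether \<open>Gs\<close> has a nonzero limit or a
    pole.\<close>
  define H where "H z = 1 / (G z - Gs z)" for z
  obtain h where Hlim: "H \<midarrow>0\<rightarrow> h"
    using ness unfolding not_essential_def
  proof (elim disjE exE)
    fix c assume c: "Gs \<midarrow>0\<rightarrow> c"
    with no_lim have "c \<noteq> 0" by auto
    then have "H \<midarrow>0\<rightarrow> 1 / (0 - c)"
      unfolding H_def by (intro tendsto_intros G0 c) auto
    then show thesis by (rule that)
  next
    assume "is_pole Gs 0"
    then have "filterlim (\<lambda>z. - Gs z) at_infinity (at 0)"
      unfolding is_pole_def by (simp add: filterlim_at_infinity_conv_norm_at_top)
    from tendsto_add_filterlim_at_infinity[OF G0 this]
    have "filterlim (\<lambda>z. G z - Gs z) at_infinity (at 0)"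
      by simp
    then have "H \<midarrow>0\<rightarrow> 0"
      unfolding H_def by (intro tendsto_divide_0[OF tendsto_const])
    then show thesis by (rule that)
  qed
  have op: "open (ball 0 e - {0::complex})" by auto
  have holH: "H holomorphic_on ball 0 e - {0}"
    unfolding H_def using diff_nonzero' by (intro holomorphic_intros holG) auto
  define g0 where "g0 z = (if z = 0 then 0 else G z)" for z
  define h0 where "h0 z = (if z = 0 then h else H z)" for z
  have g0: "g0 holomorphic_on ball 0 e" and h0: "h0 holomorphic_on ball 0 e"
    unfolding g0_def[abs_def] h0_def[abs_def]
    by (auto intro!: removable_singularity holG holH G0 Hlim)
  have g0_eq: "g0 z = G z" "deriv g0 z = deriv G z" if "z \<in> ball 0 e - {0}" for z
    using complex_derivative_transform_within_open[OF holomorphic_on_subset[OF g0] holG(1) op that] that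
    by (auto simp: g0_def)
  have h0_eq: "h0 z = H z" "deriv h0 z = deriv H z" if "z \<in> ball 0 e - {0}" for z
    using complex_derivative_transform_within_open[OF holomorphic_on_subset[OF h0] holH op that] that
    by (auto simp: h0_def)
  \<comment> \<open>A primitive of the coefficient in \<open>mderiv_F21\<close>, now extended over
    0. Consequently the (2,1) entry is a constant multiple of \<open>exp (P (exp w))\<close>,
    constancy being proved on a convex half plane.\<close>
  obtain P where P: "\<And>z. z \<in> ball 0 e \<Longrightarrow> (P has_field_derivative - deriv g0 z * h0 z) (at z)"
  proof (rule holomorphic_convex_primitive'[of "ball 0 e" "\<lambda>z. - deriv g0 z * h0 z"])
    show "(\<lambda>z. - deriv g0 z * h0 z) holomorphic_on ball 0 e"
      by (intro holomorphic_intros holomorphic_deriv g0 h0) auto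
  next
    fix g assume "\<And>x. x \<in> ball 0 e \<Longrightarrow> (g has_field_derivative - deriv g0 x * h0 x) (at x within ball 0 e)"
    then show thesis
      by (intro that[of g]) (metis at_within_open open_ball)
  qed auto
  have "\<exists>c. \<forall>w\<in>{w. Re w < ln e}. F w $ 2 $ 1 * exp (- P (exp w)) = c"
  proof (rule has_field_derivative_zero_constant)
    show "convex {w. Re w < ln e}" by (rule convex_halfspace_Re_lt)
  next
    fix w assume "w \<in> {w. Re w < ln e}"
    then have "Re w < ln e" by simp
    then have "exp (Re w) < e" using e by (metis exp_less_cancel_iff exp_ln)
    then have w: "cmod (exp w) < e" by simp
    then have z: "exp w \<in> ball 0 e - {0}" by simp
    have "((\<lambda>w. F w $ 2 $ 1 * exp (- P (exp w))) has_field_derivative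
        mderiv F w $ 2 $ 1 * exp (- P (exp w)) + exp (- P (exp w)) * (- ((- deriv g0 (exp w) * h0 (exp w)) * exp w)) * F w $ 2 $ 1) (at w)"
      by (intro DERIV_mult F_deriv in_LH[OF w] DERIV_fun_exp DERIV_minus DERIV_chain2[OF P DERIV_exp]) (use w in simp)
    moreover have "mderiv F w $ 2 $ 1 = - (exp w * deriv g0 (exp w) * h0 (exp w)) * F w $ 2 $ 1"
      using mderiv_F21[OF w refl] by (simp add: g0_eq[OF z] h0_eq[OF z] H_def)
    ultimately have "((\<lambda>w. F w $ 2 $ 1 * exp (- P (exp w))) has_field_derivative 0) (at w)"
      by (simp add: algebra_simps)
    then show "((\<lambda>w. F w $ 2 $ 1 * exp (- P (exp w))) has_field_derivative 0) (at w within {w. Re w < ln e})"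
      by (rule has_field_derivative_at_within)
  qed
  then obtain c where c: "\<And>w. Re w < ln e \<Longrightarrow> F w $ 2 $ 1 * exp (- P (exp w)) = c"
    by blast
  have F21: "F w $ 2 $ 1 = c * exp (P (exp w))" if "cmod (exp w) < e" for w
  proof -
    have "Re w < ln e" using that e by (metis exp_less_cancel_iff exp_ln norm_exp_eq_Re)
    from c[OF this] show ?thesis
      by (auto simp: exp_minus field_simps)
  qed
  have c0: "c \<noteq> 0"
  proof -
    have "cmod (exp (of_real (ln (e / 2)))) < e" using e by (simp add: exp_of_real norm_exp_eq_Re)
    from F21[OF this] nz(1)[OF this] show ?thesis by auto
  qed
  \<comment> \<open>\<open>W\<close> and \<open>T\<close> are the coefficients of
    \<open>\<omega>\<close> and \<open>\<theta>\<close> with respect to \<open>dz\<close>; both are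
    holomorphic at 0, hence bounded near it.\<close>
  define W where "W z = - (c * exp (P z))\<^sup>2 * deriv g0 z" for z
  define T where "T z = (deriv g0 z * (h0 z)\<^sup>2 + deriv h0 z) / (c * exp (P z))\<^sup>2" for z
  have forms: "om_w F w = exp w * W (exp w)" "th_w F w = exp w * T (exp w)" if w: "cmod (exp w) < e" for w
  proof -
    have z: "exp w \<in> ball 0 e - {0}" using w by simp
    show "om_w F w = exp w * W (exp w)"
      unfolding om_w_eq[OF w refl] W_def g0_eq[OF z] F21[OF w] by simp
    have H: "H (exp w) = F w $ 2 $ 1 * F w $ 2 $ 2" "H (exp w) \<noteq> 0"
      unfolding H_def diff_eq[OF w refl] using nz[OF w] by auto
    have dH: "(H has_field_derivative deriv H (exp w)) (at (exp w))"
      and dG: "(G has_field_derivative deriv G (exp w)) (at (exp w))"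
      using holH holG op z holomorphic_derivI by blast+
    \<comment> \<open>Since \<open>Gs = G - 1 / H\<close>, its derivative is expressed through
      \<open>G\<close> and \<open>H\<close>, which extend over 0, whereas \<open>Gs\<close> may have
      a pole.\<close>
    have d: "((\<lambda>z. G z - 1 / H z) has_field_derivative deriv G (exp w) + deriv H (exp w) / (H (exp w))\<^sup>2) (at (exp w))"
      using H(2) by (auto intro!: derivative_eq_intros dG dH simp: power2_eq_square)
    have "\<forall>\<^sub>F z in nhds (exp w). G z - 1 / H z = Gs z"
      using eventually_nhds_in_open[OF op z] by eventually_elim (use diff_nonzero' in \<open>auto simp: H_def\<close>)
    from DERIV_cong_ev[OF refl this refl] d
    have "(Gs has_field_derivative deriv G (exp w) + deriv H (exp w) / (H (exp w))\<^sup>2) (at (exp w))"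
      by blast
    then have dGs: "deriv Gs (exp w) = deriv G (exp w) + deriv H (exp w) / (H (exp w))\<^sup>2"
      by (rule DERIV_imp_deriv)
    have F22: "F w $ 2 $ 2 = H (exp w) / (c * exp (P (exp w)))"
      using H nz[OF w] F21[OF w] by (simp add: field_simps)
    show "th_w F w = exp w * T (exp w)"
      unfolding th_w_eq[OF w refl] T_def g0_eq[OF z] h0_eq[OF z] dGs F22
      using H(2) c0 by (simp add: field_simps)
  qed
  have holP: "P holomorphic_on ball 0 e"
    unfolding holomorphic_on_open[OF open_ball] using P by blast
  have "W holomorphic_on ball 0 e" "T holomorphic_on ball 0 e"
    unfolding W_def T_def using c0 by (intro holomorphic_intros holomorphic_deriv holP g0 h0; simp)+
  then have cont: "continuous_on (cball 0 (e / 2)) W" "continuous_on (cball 0 (e / 2)) T"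
    using e by (auto intro!: holomorphic_on_imp_continuous_on elim!: holomorphic_on_subset)
  have "continuous_on (cball 0 (e / 2)) (\<lambda>z. sqrt ((cmod (W z))\<^sup>2 + (cmod (T z))\<^sup>2))"
    by (intro continuous_intros cont)
  then have "bounded ((\<lambda>z. sqrt ((cmod (W z))\<^sup>2 + (cmod (T z))\<^sup>2)) ` cball 0 (e / 2))"
    by (intro compact_imp_bounded compact_continuous_image) auto
  then obtain B where B: "\<And>z. cmod z \<le> e / 2 \<Longrightarrow> sqrt ((cmod (W z))\<^sup>2 + (cmod (T z))\<^sup>2) \<le> B"
    unfolding bounded_iff by force
  \<comment> \<open>The lift of the radial segment running from \<open>e / 2\<close> to 0 at
    constant speed.\<close>
  define \<gamma> :: "real \<Rightarrow> complex" where "\<gamma> s = of_real (ln (e / 2 * (1 - s)))" for s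
  have exp\<gamma>: "exp (\<gamma> s) = of_real (e / 2 * (1 - s))" if "s < 1" for s
    unfolding \<gamma>_def exp_of_real using that e by (subst exp_ln) auto
  have d\<gamma>: "(\<gamma> has_vector_derivative of_real (- (1 / (1 - s)))) (at s)" if "s < 1" for s
    unfolding \<gamma>_def using that e
    by (intro has_vector_derivative_of_real) (auto intro!: derivative_eq_intros simp: field_simps)
  have "\<gamma> ` {0..<1} \<subseteq> LH"
  proof safe
    fix s :: real assume "s \<in> {0..<1}"
    then have s: "0 \<le> s" "s < 1" by auto
    then have "e / 2 * (1 - s) \<le> 1 / 2 * 1" using e by (intro mult_mono) auto
    then have "cmod (exp (\<gamma> s)) < 1" unfolding exp\<gamma>[OF s(2)] norm_of_real using s e by simp
    then show "\<gamma> s \<in> LH" unfolding exp_in_unit_disc_iff .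
  qed
  moreover have "\<gamma> piecewise_C1_differentiable_on {0..b}" if "b \<in> {0..<1}" for b
  proof (rule C1_differentiable_imp_piecewise)
    show "\<gamma> C1_differentiable_on {0..b}"
      unfolding C1_differentiable_on_def using that
      by (intro exI[of _ "\<lambda>s. of_real (- (1 / (1 - s)))"]) (auto intro!: d\<gamma> continuous_intros simp del: of_real_divide of_real_minus)
  qed
  moreover have "filterlim (\<lambda>s. Re (\<gamma> s)) at_bot (at_left 1)"
  proof -
    have "((\<lambda>s. e / 2 * (1 - s)) \<longlongrightarrow> e / 2 * (1 - 1)) (at_left 1)"
      by (intro tendsto_intros)
    moreover have "\<forall>\<^sub>F s in at_left 1. e / 2 * (1 - s) \<in> {0<..}"
      using e by (auto simp: eventually_at_filter)
    ultimately have "filterlim (\<lambda>s. e / 2 * (1 - s)) (at_right 0) (at_left 1)"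
      unfolding filterlim_at by (auto elim: eventually_mono)
    from filterlim_compose[OF ln_at_0 this] show ?thesis
      by (simp add: \<gamma>_def)
  qed
  ultimately have "(\<integral>\<^sup>+ s\<in>{0..<1}. ennreal (rho_w F (\<gamma> s) * norm (vector_derivative \<gamma> (at s))) \<partial>lborel) = \<infinity>"
    using complete unfolding complete_at_0_def by blast
  moreover have "(\<integral>\<^sup>+ s\<in>{0..<1}. ennreal (rho_w F (\<gamma> s) * norm (vector_derivative \<gamma> (at s))) \<partial>lborel)
      \<le> (\<integral>\<^sup>+ s. ennreal (e / 2 * B) * indicator {0..<1::real} s \<partial>lborel)"
  proof (rule nn_integral_mono)
    fix s :: real
    show "ennreal (rho_w F (\<gamma> s) * norm (vector_derivative \<gamma> (at s))) * indicator {0..<1} s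
        \<le> ennreal (e / 2 * B) * indicator {0..<1} s"
    proof (cases "s \<in> {0..<1}")
      case True
      then have s: "0 \<le> s" "s < 1" by auto
      define z where "z = exp (\<gamma> s)"
      have cz: "cmod z = e / 2 * (1 - s)"
        using s e unfolding z_def exp\<gamma>[OF s(2)] norm_of_real by simp
      also have "\<dots> \<le> e / 2 * 1"
        using s e by (intro mult_left_mono) auto
      finally have z: "cmod z \<le> e / 2" by simp
      then have "cmod (exp (\<gamma> s)) < e" using e by (simp add: z_def)
      note f = forms[OF this, folded z_def]
      \<comment> \<open>The factor \<open>cmod z = e / 2 * (1 - s)\<close> cancels the speed
        \<open>1 / (1 - s)\<close> of the lifted curve, so the length is finite.\<close>
      have "rho_w F (\<gamma> s) = cmod z * sqrt ((cmod (W z))\<^sup>2 + (cmod (T z))\<^sup>2)"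
        unfolding rho_w_def f norm_mult power_mult_distrib distrib_left[symmetric] real_sqrt_mult by simp
      moreover have "norm (vector_derivative \<gamma> (at s)) = 1 / (1 - s)"
        unfolding vector_derivative_at[OF d\<gamma>[OF s(2)]] norm_of_real using s by simp
      ultimately have "rho_w F (\<gamma> s) * norm (vector_derivative \<gamma> (at s)) = e / 2 * sqrt ((cmod (W z))\<^sup>2 + (cmod (T z))\<^sup>2)"
        using s cz by simp
      also have "\<dots> \<le> e / 2 * B"
        using B[OF z] e by (intro mult_left_mono) auto
      finally show ?thesis
        using True by (simp add: ennreal_leI)
    qed simp
  qed
  moreover have "(\<integral>\<^sup>+ s. ennreal (e / 2 * B) * indicator {0..<1::real} s \<partial>lborel) < \<infinity>"
    by (simp add: nn_integral_cmult_indicator ennreal_mult_less_top)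
  ultimately show False by (simp add: leD)
qed

end

section \<open>Orders of the Gauss maps at the end\<close>

lemma deriv_power_mult:
  fixes G u :: "complex \<Rightarrow> complex"
  assumes n: "0 < n" and u: "u holomorphic_on ball 0 d"
    and G: "\<And>z. z \<in> ball 0 d - {0} \<Longrightarrow> G z = z ^ n * u z" and z: "z \<in> ball 0 d - {0}"
  shows "deriv G z = z ^ (n - 1) * (of_nat n * u z + z * deriv u z)"
proof (rule DERIV_imp_deriv)
  have du: "(u has_field_derivative deriv u z) (at z)"
    using z by (auto intro: holomorphic_derivI[OF u])
  have "z ^ n = z ^ (n - 1) * z"
    using n by (cases n) auto
  then have "((\<lambda>z. z ^ n * u z) has_field_derivative z ^ (n - 1) * (of_nat n * u z + z * deriv u z)) (at z)"
    by (auto intro!: derivative_eq_intros du simp: algebra_simps)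
  moreover have "open (ball 0 d - {0::complex})" by auto
  from eventually_nhds_in_open[OF this z] have "\<forall>\<^sub>F x in nhds z. G x = x ^ n * u x"
    by eventually_elim (rule G)
  note DERIV_cong_ev[OF refl this refl]
  ultimately show "(G has_field_derivative z ^ (n - 1) * (of_nat n * u z + z * deriv u z)) (at z)"
    by simp
qed

text \<open>After removing the singularity, a nonconstant \<open>G\<close> has a zero of finite
  order \<open>n\<close>. Its derivative has order \<open>n - 1\<close>, so the \<open>+ 1\<close>
  in \<open>multiplicity\<close> recovers \<open>n\<close>.\<close>

lemma zero_factorization:
  assumes e: "0 < e" and G: "G holomorphic_on ball 0 e - {0}" "G \<midarrow>0\<rightarrow> 0" and nc: "\<not> const_near_0 G"
  obtains n u d where "0 < n" "0 < d" "d \<le> e" "u holomorphic_on ball 0 d" "u 0 \<noteq> 0"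
    "\<And>z. z \<in> ball 0 d - {0} \<Longrightarrow> G z = z ^ n * u z" "zorder (deriv G) 0 = int n - 1"
proof -
  define g where "g z = (if z = 0 then 0 else G z)" for z
  have g: "g holomorphic_on ball 0 e"
    unfolding g_def[abs_def] by (auto intro!: removable_singularity G)
  have "\<exists>w\<in>ball 0 e. g w \<noteq> 0"
  proof (rule ccontr)
    assume "\<not> (\<exists>w\<in>ball 0 e. g w \<noteq> 0)"
    then have "\<forall>\<^sub>F z in at 0. G z = 0"
      using e unfolding eventually_at by (intro exI[of _ e]) (auto simp: g_def split: if_splits)
    with nc show False by (auto simp: const_near_0_def)
  qed
  moreover have "0 \<in> ball 0 e" "g 0 = 0"
    using e by (auto simp: g_def)
  ultimately obtain r where
    n: "zorder g 0 > 0" and r: "r > 0" "cball (0::complex) r \<subseteq> ball 0 e"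
    and u: "zor_poly g 0 holomorphic_on cball 0 r"
    and gu: "\<And>w. w \<in> cball 0 r \<Longrightarrow> g w = zor_poly g 0 w * w ^ nat (zorder g 0) \<and> zor_poly g 0 w \<noteq> 0"
    using zorder_exist_zero[OF g open_ball connected_ball, of 0] by auto
  define n where "n = nat (zorder g 0)"
  define u where "u = zor_poly g 0"
  have hu: "u holomorphic_on ball 0 r"
    using u by (auto simp: u_def elim: holomorphic_on_subset)
  have Gu: "G z = z ^ n * u z" if "z \<in> ball 0 r - {0}" for z
    using gu[of z] that by (auto simp: g_def n_def u_def mult.commute)
  have n0: "0 < n" using n by (simp add: n_def)
  have u0: "u 0 \<noteq> 0" using gu[of 0] r by (simp add: u_def)
  have "zorder (deriv G) 0 = int (n - 1)"
  proof (rule zorder_eqI)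
    show "(\<lambda>z. of_nat n * u z + z * deriv u z) holomorphic_on ball 0 r"
      by (intro holomorphic_intros holomorphic_deriv hu) auto
    show "of_nat n * u 0 + 0 * deriv u 0 \<noteq> 0"
      using n0 u0 by simp
    show "deriv G w = (of_nat n * u w + w * deriv u w) * (w - 0) powi int (n - 1)"
      if "w \<in> ball 0 r" "w \<noteq> 0" for w
      using deriv_power_mult[OF n0 hu Gu, of w] that by (simp add: power_int_of_nat del: of_nat_diff)
  qed (use r in auto)
  moreover have "r \<le> e"
    using r subsetD[OF r(2), of "of_real r"] by simp
  ultimately show thesis
    using that[OF n0 r(1) _ hu u0 Gu] n0 by (simp add: of_nat_diff)
qed

text \<open>The exponent is the smaller of the two zero orders, so the function attaining it keeps a
  nonzero leading coefficient. A constant Gauss map is zero near 0 and gets the cofactor 0; both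
  cannot be constant, as they differ everywhere.\<close>

lemma common_factorization:
  assumes e: "0 < e"
    and G: "G holomorphic_on ball 0 e - {0}" "G \<midarrow>0\<rightarrow> 0"
    and Gs: "Gs holomorphic_on ball 0 e - {0}" "Gs \<midarrow>0\<rightarrow> 0"
    and ne: "\<And>z. z \<in> ball 0 e - {0} \<Longrightarrow> G z \<noteq> Gs z"
  obtains n u v d where "0 < n" "0 < d" "d \<le> e" "u holomorphic_on ball 0 d" "v holomorphic_on ball 0 d"
    "u 0 \<noteq> 0 \<or> v 0 \<noteq> 0" "\<And>z. z \<in> ball 0 d - {0} \<Longrightarrow> G z = z ^ n * u z"
    "\<And>z. z \<in> ball 0 d - {0} \<Longrightarrow> Gs z = z ^ n * v z" "multiplicity G Gs = int n"
proof -
  have zero: "\<exists>d. 0 < d \<and> (\<forall>z\<in>ball 0 d - {0}. g z = 0)" if "const_near_0 g" "g \<midarrow>0\<rightarrow> 0" for g :: "complex \<Rightarrow> complex"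
  proof -
    obtain c where c: "\<forall>\<^sub>F z in at 0. g z = c" using \<open>const_near_0 g\<close> by (auto simp: const_near_0_def)
    then have "g \<midarrow>0\<rightarrow> c" by (rule tendsto_eventually)
    then have "c = 0" using \<open>g \<midarrow>0\<rightarrow> 0\<close> by (metis LIM_unique)
    with c obtain d where "0 < d" "\<And>z. z \<noteq> 0 \<Longrightarrow> cmod z < d \<Longrightarrow> g z = 0"
      by (auto simp: eventually_at)
    then show ?thesis by (intro exI[of _ d]) auto
  qed
  show thesis
  proof (cases "const_near_0 G")
    case True
    then obtain d1 where d1: "0 < d1" "\<And>z. z \<in> ball 0 d1 - {0} \<Longrightarrow> G z = 0"
      using zero[OF True G(2)] by blast
    have nc: "\<not> const_near_0 Gs"
    proof
      assume "const_near_0 Gs"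
      then obtain d2 where d2: "0 < d2" "\<And>z. z \<in> ball 0 d2 - {0} \<Longrightarrow> Gs z = 0"
        using zero[OF _ Gs(2)] by blast
      \<comment> \<open>A point lying in all three discs, where both Gauss maps would be 0.\<close>
      define z where "z = complex_of_real (Min {e, d1, d2} / 2)"
      have "z \<noteq> 0" "cmod z < e" "cmod z < d1" "cmod z < d2"
        using e d1(1) d2(1) by (auto simp: z_def)
      then show False using ne[of z] d1(2)[of z] d2(2)[of z] by simp
    qed
    obtain n v d where *: "0 < n" "0 < d" "d \<le> e" "v holomorphic_on ball 0 d" "v 0 \<noteq> 0"
      "\<And>z. z \<in> ball 0 d - {0} \<Longrightarrow> Gs z = z ^ n * v z" "zorder (deriv Gs) 0 = int n - 1"
      using zero_factorization[OF e Gs nc] by metis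
    show thesis
    proof (rule that[of n "min d d1" "\<lambda>_. 0" v])
      show "v holomorphic_on ball 0 (min d d1)"
        by (rule holomorphic_on_subset[OF *(4)]) auto
    qed (use * d1 True in \<open>auto simp: multiplicity_def\<close>)
  next
    case ncG: False
    obtain k u d where u: "0 < k" "0 < d" "d \<le> e" "u holomorphic_on ball 0 d" "u 0 \<noteq> 0"
      "\<And>z. z \<in> ball 0 d - {0} \<Longrightarrow> G z = z ^ k * u z" "zorder (deriv G) 0 = int k - 1"
      using zero_factorization[OF e G ncG] by metis
    show thesis
    proof (cases "const_near_0 Gs")
      case True
      then obtain d1 where d1: "0 < d1" "\<And>z. z \<in> ball 0 d1 - {0} \<Longrightarrow> Gs z = 0"
        using zero[OF True Gs(2)] by blast
      show thesis
      proof (rule that[of k "min d d1" u "\<lambda>_. 0"])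
        show "u holomorphic_on ball 0 (min d d1)"
          by (rule holomorphic_on_subset[OF u(4)]) auto
      qed (use u d1 True ncG in \<open>auto simp: multiplicity_def\<close>)
    next
      case ncGs: False
      obtain l v d' where v: "0 < l" "0 < d'" "d' \<le> e" "v holomorphic_on ball 0 d'" "v 0 \<noteq> 0"
        "\<And>z. z \<in> ball 0 d' - {0} \<Longrightarrow> Gs z = z ^ l * v z" "zorder (deriv Gs) 0 = int l - 1"
        using zero_factorization[OF e Gs ncGs] by metis
      show thesis
      proof (rule that[of "min k l" "min d d'" "\<lambda>z. z ^ (k - min k l) * u z" "\<lambda>z. z ^ (l - min k l) * v z"])
        show "(\<lambda>z. z ^ (k - min k l) * u z) holomorphic_on ball 0 (min d d')"
          by (intro holomorphic_intros holomorphic_on_subset[OF u(4)]) auto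
        show "(\<lambda>z. z ^ (l - min k l) * v z) holomorphic_on ball 0 (min d d')"
          by (intro holomorphic_intros holomorphic_on_subset[OF v(4)]) auto
        show "0 ^ (k - min k l) * u 0 \<noteq> 0 \<or> 0 ^ (l - min k l) * v 0 \<noteq> 0"
          using u(5) v(5) by (cases "k \<le> l") (auto simp: min_def)
        show "G z = z ^ min k l * (z ^ (k - min k l) * u z)" if "z \<in> ball 0 (min d d') - {0}" for z
          using u(6)[of z] that by (simp flip: mult.assoc power_add)
        show "Gs z = z ^ min k l * (z ^ (l - min k l) * v z)" if "z \<in> ball 0 (min d d') - {0}" for z
          using v(6)[of z] that by (simp flip: mult.assoc power_add)
        show "multiplicity G Gs = int (min k l)"
          using ncG ncGs u(7) v(7) by (simp add: multiplicity_def min_def)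
      qed (use u v in auto)
    qed
  qed
qed

text \<open>If \<open>G\<close> is constant, the first quotient in \<^const>\<open>is_alpha\<close> vanishes identically because
  \<open>x / 0 = 0\<close>; this is by coincidence the correct value of \<open>\<alpha>\<close>.\<close>
lemma is_alpha_cases:
  assumes alpha: "is_alpha G Gs \<alpha>"
    and U: "U \<midarrow>0\<rightarrow> of_nat n * u0" and V: "V \<midarrow>0\<rightarrow> of_nat n * v0" and n: "0 < n"
    and GU: "\<forall>\<^sub>F z in at 0. deriv G z = z ^ k * U z" and GV: "\<forall>\<^sub>F z in at 0. deriv Gs z = z ^ k * V z"
    and nz: "u0 \<noteq> 0 \<or> v0 \<noteq> 0"
  shows "u0 \<noteq> 0 \<and> \<alpha> = v0 / u0 \<or> v0 \<noteq> 0 \<and> \<alpha> = u0 / v0"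
proof -
  let ?r = "\<lambda>z. deriv Gs z / deriv G z" and ?r' = "\<lambda>z. deriv G z / deriv Gs z"
  have nz0: "\<forall>\<^sub>F z in at (0::complex). z \<noteq> 0"
    by (simp add: eventually_at_filter)
  have r: "\<forall>\<^sub>F z in at 0. V z / U z = ?r z" "\<forall>\<^sub>F z in at 0. U z / V z = ?r' z"
    using GU GV nz0 by (eventually_elim; simp)+
  have r_lim: "?r \<midarrow>0\<rightarrow> v0 / u0" if "u0 \<noteq> 0"
    using tendsto_cong[OF r(1)] tendsto_divide[OF V U] that n by simp
  have r'_lim: "?r' \<midarrow>0\<rightarrow> u0 / v0" if "v0 \<noteq> 0"
    using tendsto_cong[OF r(2)] tendsto_divide[OF U V] that n by simp
  show ?thesis
  proof (cases "u0 = 0")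
    case False
    note lim = r_lim[OF False]
    show ?thesis
    proof (cases "cmod (v0 / u0) \<le> 1")
      case True
      then have "?r \<midarrow>0\<rightarrow> \<alpha>"
        using alpha lim unfolding is_alpha_def by (auto split: if_splits)
      then have "\<alpha> = v0 / u0" using lim by (rule LIM_unique)
      then show ?thesis using False by simp
    next
      case big: False
      then have v0: "v0 \<noteq> 0" by auto
      \<comment> \<open>The limit of \<open>?r\<close> is unique and has modulus above 1, so
        \<open>is_alpha\<close> takes its second branch.\<close>
      have "\<not> (\<exists>c. ?r \<midarrow>0\<rightarrow> c \<and> cmod c \<le> 1)"
        using big LIM_unique[OF lim] by auto
      then have "?r' \<midarrow>0\<rightarrow> \<alpha>"
        using alpha unfolding is_alpha_def by (auto split: if_splits)
      then have "\<alpha> = u0 / v0" using r'_lim[OF v0] by (rule LIM_unique)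
      then show ?thesis using v0 by simp
    qed
  next
    case u0: True
    with nz have v0: "v0 \<noteq> 0" by simp
    have r'0: "?r' \<midarrow>0\<rightarrow> 0" using r'_lim[OF v0] u0 by simp
    have "\<alpha> = 0"
    proof (cases "\<exists>c. ?r \<midarrow>0\<rightarrow> c \<and> cmod c \<le> 1")
      case True
      then have ra: "?r \<midarrow>0\<rightarrow> \<alpha>"
        using alpha unfolding is_alpha_def by (simp split: if_splits)
      \<comment> \<open>The product of the two quotients is 1 where both derivatives are nonzero and
        0 elsewhere. Tending to 0, it is eventually 0, which forces \<open>?r\<close> to
        vanish.\<close>
      from tendsto_mult[OF this r'0] have "(\<lambda>z. ?r z * ?r' z) \<midarrow>0\<rightarrow> 0" by simp
      from tendstoD[OF this, of 1] have "\<forall>\<^sub>F z in at 0. cmod (?r z * ?r' z) < 1" by simp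
      then have "\<forall>\<^sub>F z in at 0. ?r z = 0"
        by eventually_elim (auto simp: divide_simps split: if_splits)
      then have "?r \<midarrow>0\<rightarrow> 0" by (rule tendsto_eventually)
      with ra show ?thesis by (metis LIM_unique)
    next
      case False
      then have "?r' \<midarrow>0\<rightarrow> \<alpha>"
        using alpha unfolding is_alpha_def by (simp split: if_splits)
      then show ?thesis using r'0 by (rule LIM_unique)
    qed
    then show ?thesis using u0 v0 by simp
  qed
qed

section \<open>Limits of the Hopf differential and of the flux form at the end\<close>

context gauss_chart
begin

lemma hopf_tendsto:
  assumes hopf: "hopf_top_coeff F q"
  shows "((\<lambda>z. om_w F (Ln z) * th_w F (Ln z)) \<longlongrightarrow> q) (at 0)"
proof (rule tendstoI)
  fix \<epsilon> :: real assume "\<epsilon> > 0"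
  then obtain R where R: "\<And>w. Re w < R \<Longrightarrow> cmod (om_w F w * th_w F w - q) < \<epsilon>"
    using hopf unfolding hopf_top_coeff_def by blast
  have "dist (om_w F (Ln z) * th_w F (Ln z)) q < \<epsilon>" if "z \<noteq> 0" "dist z 0 < exp R" for z
  proof -
    have "Re (Ln z) < R"
      using that by (simp add: ln_less_cancel_iff[of "cmod z" "exp R", simplified])
    from R[OF this] show ?thesis by (simp add: dist_norm)
  qed
  then show "\<forall>\<^sub>F z in at 0. dist (om_w F (Ln z) * th_w F (Ln z)) q < \<epsilon>"
    unfolding eventually_at by (intro exI[of _ "exp R"]) auto
qed

text \<open>Since \<open>z * deriv\<close> preserves the factor \<open>z ^ n\<close>, all powers
  cancel in the Hopf differential and in the diagonal entry, while one factor \<open>z ^ n\<close>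
  survives in the (1,2) entry. The (2,1) entry, which may grow like the power \<open>-n\<close>, is
  not followed.\<close>

lemma end_asymptotics:
  assumes complete: "complete_at_0 F" and G0: "G \<midarrow>0\<rightarrow> 0" and ness: "not_essential Gs 0"
    and alpha: "is_alpha G Gs \<alpha>" and hopf: "hopf_top_coeff F q"
  defines "m \<equiv> multiplicity G Gs"
  defines "\<mu> \<equiv> 2 * of_int m * \<alpha> / (1 - \<alpha>)\<^sup>2"
  shows "m > 0" "\<alpha> \<noteq> 1" "\<mu> = - (2 * q / of_int m)"
    "((\<lambda>z. log_mderiv F (Ln z) $ 1 $ 1) \<longlongrightarrow> - \<mu>) (at 0)"
    "((\<lambda>z. log_mderiv F (Ln z) $ 1 $ 2) \<longlongrightarrow> 0) (at 0)"
proof -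
  obtain n u v d where n: "0 < n" and d: "0 < d" "d \<le> e"
    and u: "u holomorphic_on ball 0 d" and v: "v holomorphic_on ball 0 d" and nz0: "u 0 \<noteq> 0 \<or> v 0 \<noteq> 0"
    and Gu: "\<And>z. z \<in> ball 0 d - {0} \<Longrightarrow> G z = z ^ n * u z"
    and Gv: "\<And>z. z \<in> ball 0 d - {0} \<Longrightarrow> Gs z = z ^ n * v z" and mult: "multiplicity G Gs = int n"
    using common_factorization[OF e(1) holG(1) G0 holG(2) Gs_tendsto_0[OF complete G0 ness] diff_nonzero'] by metis
  have m: "m = int n" by (simp add: m_def mult)
  define U where "U z = of_nat n * u z + z * deriv u z" for z
  define V where "V z = of_nat n * v z + z * deriv v z" for z
  have "U holomorphic_on ball 0 d" "V holomorphic_on ball 0 d"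
    unfolding U_def V_def by (auto intro!: holomorphic_intros holomorphic_deriv u v)
  then have "isCont U 0" "isCont V 0" "isCont u 0" "isCont v 0"
    using u v d by (auto dest!: holomorphic_on_imp_continuous_on simp: continuous_on_eq_continuous_at)
  then have lims: "U \<midarrow>0\<rightarrow> of_nat n * u 0" "V \<midarrow>0\<rightarrow> of_nat n * v 0" "u \<midarrow>0\<rightarrow> u 0" "v \<midarrow>0\<rightarrow> v 0"
    by (auto simp: isCont_def U_def V_def)
  have near: "\<forall>\<^sub>F z in at (0::complex). z \<in> ball 0 d - {0}"
    using d unfolding eventually_at by (intro exI[of _ d]) auto
  have dG: "deriv G z = z ^ (n - 1) * U z" "deriv Gs z = z ^ (n - 1) * V z" if "z \<in> ball 0 d - {0}" for z
    using deriv_power_mult[OF n u Gu that] deriv_power_mult[OF n v Gv that] by (simp_all add: U_def V_def)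
  have zdG: "z * deriv G z = z ^ n * U z" "z * deriv Gs z = z ^ n * V z" if "z \<in> ball 0 d - {0}" for z
    using n unfolding dG[OF that] by (cases n; simp)+
  have uv: "u z \<noteq> v z" if "z \<in> ball 0 d - {0}" for z
    using diff_nonzero'[of z] that Gu[OF that] Gv[OF that] d by auto
  have Ln: "cmod (exp (Ln z)) < e" "z = exp (Ln z)" if "z \<in> ball 0 d - {0}" for z
    using that d by auto
  have diff: "(G z - Gs z)\<^sup>2 = (z ^ n)\<^sup>2 * (u z - v z)\<^sup>2" if "z \<in> ball 0 d - {0}" for z
    unfolding Gu[OF that] Gv[OF that] by (simp add: power_mult_distrib flip: right_diff_distrib)
  have om_th: "om_w F (Ln z) * th_w F (Ln z) = - (U z * V z / (u z - v z)\<^sup>2)" if z: "z \<in> ball 0 d - {0}" for z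
  proof -
    have "om_w F (Ln z) * th_w F (Ln z) = - ((z * deriv G z) * (z * deriv Gs z) / (G z - Gs z)\<^sup>2)"
      unfolding hopf_eq[OF Ln[OF z]] by (simp add: power2_eq_square mult_ac)
    also have "\<dots> = - (U z * V z / (u z - v z)\<^sup>2)"
      unfolding zdG[OF z] diff[OF z] using z by (simp add: power2_eq_square)
    finally show ?thesis .
  qed
  have q_lim: "(\<lambda>z. - (U z * V z / (u z - v z)\<^sup>2)) \<midarrow>0\<rightarrow> q"
    by (rule Lim_transform_eventually[OF hopf_tendsto[OF hopf]]) (use near in \<open>auto elim!: eventually_mono intro!: om_th\<close>)
  have ne: "u 0 \<noteq> v 0"
  proof
    assume eq: "u 0 = v 0"
    \<comment> \<open>Clearing the denominator: with equal leading coefficients the left limit is 0,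
      but \<open>U z * V z\<close> has a nonzero limit.\<close>
    have "(\<lambda>z. - (U z * V z / (u z - v z)\<^sup>2) * (u z - v z)\<^sup>2) \<midarrow>0\<rightarrow> q * (u 0 - v 0)\<^sup>2"
      by (intro tendsto_intros q_lim lims)
    moreover have "\<forall>\<^sub>F z in at 0. - (U z * V z / (u z - v z)\<^sup>2) * (u z - v z)\<^sup>2 = - (U z * V z)"
      using near by eventually_elim (use uv in auto)
    ultimately have "(\<lambda>z. - (U z * V z)) \<midarrow>0\<rightarrow> q * (u 0 - v 0)\<^sup>2"
      by (rule Lim_transform_eventually)
    moreover have "(\<lambda>z. - (U z * V z)) \<midarrow>0\<rightarrow> - ((of_nat n * u 0) * (of_nat n * v 0))"
      by (intro tendsto_intros lims)
    ultimately have "q * (u 0 - v 0)\<^sup>2 = - ((of_nat n * u 0) * (of_nat n * v 0))"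
      by (rule LIM_unique)
    then show False using eq nz0 n by auto
  qed
  have "(\<lambda>z. - (U z * V z / (u z - v z)\<^sup>2)) \<midarrow>0\<rightarrow> - ((of_nat n * u 0) * (of_nat n * v 0) / (u 0 - v 0)\<^sup>2)"
    using ne by (intro tendsto_intros lims) auto
  with q_lim have q: "q = - ((of_nat n * u 0) * (of_nat n * v 0) / (u 0 - v 0)\<^sup>2)"
    by (rule LIM_unique)
  have \<alpha>: "u 0 \<noteq> 0 \<and> \<alpha> = v 0 / u 0 \<or> v 0 \<noteq> 0 \<and> \<alpha> = u 0 / v 0"
    by (rule is_alpha_cases[OF alpha lims(1,2) n _ _ nz0, of "n - 1"])
      (rule eventually_mono[OF near], erule dG)+
  show "\<alpha> \<noteq> 1" using \<alpha> ne by auto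
  \<comment> \<open>The expression is invariant under replacing \<open>\<alpha>\<close> by its
    inverse, so both branches of \<open>is_alpha\<close> give the same value.\<close>
  have "\<alpha> / (1 - \<alpha>)\<^sup>2 = u 0 * v 0 / (u 0 - v 0)\<^sup>2"
  proof -
    have *: "\<alpha> / (1 - \<alpha>)\<^sup>2 = x * y / (x - y)\<^sup>2" if "x \<noteq> 0" "\<alpha> = y / x" for x y
    proof -
      have y: "y = x * \<alpha>" using that by simp
      have "x - y = x * (1 - \<alpha>)" by (simp add: y algebra_simps)
      then have "x * y / (x - y)\<^sup>2 = (x\<^sup>2 * \<alpha>) / (x\<^sup>2 * (1 - \<alpha>)\<^sup>2)"
        by (simp only: power_mult_distrib) (simp add: y power2_eq_square)
      then show ?thesis using that by simp
    qed
    show ?thesis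
      using \<alpha> *[of "u 0" "v 0"] *[of "v 0" "u 0"] by (auto simp: mult.commute power2_commute)
  qed
  then have \<mu>: "\<mu> = 2 * of_nat n * (u 0 * v 0 / (u 0 - v 0)\<^sup>2)"
    by (simp add: \<mu>_def m flip: times_divide_eq_right)
  show "m > 0" using n by (simp add: m)
  show "\<mu> = - (2 * q / of_int m)"
    unfolding \<mu> q m using n by (simp add: field_simps)
  show "((\<lambda>z. log_mderiv F (Ln z) $ 1 $ 1) \<longlongrightarrow> - \<mu>) (at 0)"
  proof (rule Lim_transform_eventually)
    have "(\<lambda>z. - ((U z * v z + u z * V z) / (u z - v z)\<^sup>2)) \<midarrow>0\<rightarrow>
        - ((of_nat n * u 0 * v 0 + u 0 * (of_nat n * v 0)) / (u 0 - v 0)\<^sup>2)"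
      using ne by (intro tendsto_intros lims) auto
    then show "(\<lambda>z. - ((U z * v z + u z * V z) / (u z - v z)\<^sup>2)) \<midarrow>0\<rightarrow> - \<mu>"
      by (simp add: \<mu> mult_ac)
    show "\<forall>\<^sub>F z in at 0. - ((U z * v z + u z * V z) / (u z - v z)\<^sup>2) = log_mderiv F (Ln z) $ 1 $ 1"
      using near
    proof eventually_elim
      case (elim z)
      have "log_mderiv F (Ln z) $ 1 $ 1 = - (((z * deriv G z) * Gs z + G z * (z * deriv Gs z)) / (G z - Gs z)\<^sup>2)"
        unfolding log_mderiv_eqs(1)[OF Ln[OF elim]] minus_divide_left by (simp add: algebra_simps)
      also have "\<dots> = - (((z ^ n)\<^sup>2 * (U z * v z + u z * V z)) / ((z ^ n)\<^sup>2 * (u z - v z)\<^sup>2))"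
        unfolding zdG[OF elim] diff[OF elim] Gu[OF elim] Gv[OF elim] by (simp add: algebra_simps power2_eq_square)
      finally show ?case using elim by simp
    qed
  qed
  show "((\<lambda>z. log_mderiv F (Ln z) $ 1 $ 2) \<longlongrightarrow> 0) (at 0)"
  proof (rule Lim_transform_eventually)
    have "(\<lambda>z. z ^ n * (((v z)\<^sup>2 * U z + (u z)\<^sup>2 * V z) / (u z - v z)\<^sup>2)) \<midarrow>0\<rightarrow>
        0 ^ n * (((v 0)\<^sup>2 * (of_nat n * u 0) + (u 0)\<^sup>2 * (of_nat n * v 0)) / (u 0 - v 0)\<^sup>2)"
      using ne by (intro tendsto_intros lims) auto
    then show "(\<lambda>z. z ^ n * (((v z)\<^sup>2 * U z + (u z)\<^sup>2 * V z) / (u z - v z)\<^sup>2)) \<midarrow>0\<rightarrow> 0"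
      using n by (simp only: power_0_left) simp
    show "\<forall>\<^sub>F z in at 0. z ^ n * (((v z)\<^sup>2 * U z + (u z)\<^sup>2 * V z) / (u z - v z)\<^sup>2) = log_mderiv F (Ln z) $ 1 $ 2"
      using near
    proof eventually_elim
      case (elim z)
      have "log_mderiv F (Ln z) $ 1 $ 2 = ((Gs z)\<^sup>2 * (z * deriv G z) + (G z)\<^sup>2 * (z * deriv Gs z)) / (G z - Gs z)\<^sup>2"
        unfolding log_mderiv_eqs(2)[OF Ln[OF elim]] by (simp add: algebra_simps)
      also have "\<dots> = ((z ^ n)\<^sup>2 * (z ^ n * ((v z)\<^sup>2 * U z + (u z)\<^sup>2 * V z))) / ((z ^ n)\<^sup>2 * (u z - v z)\<^sup>2)"
        unfolding zdG[OF elim] diff[OF elim] Gu[OF elim] Gv[OF elim] by (simp add: algebra_simps power2_eq_square)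
      finally show ?case using elim by simp
    qed
  qed
qed

end

section \<open>The flux matrix\<close>

lemma has_contour_integral_conjugate:
  fixes A :: "complex \<Rightarrow> complex^2^2" and a b J :: "complex^2^2"
  assumes "\<And>i j. ((\<lambda>z. A z $ i $ j) has_contour_integral J $ i $ j) g"
  shows "((\<lambda>z. (a ** A z ** b) $ i $ j) has_contour_integral (a ** J ** b) $ i $ j) g"
  unfolding matrix_matrix_mult_def vec_lambda_beta
  by (intro has_contour_integral_sum has_contour_integral_rmul has_contour_integral_lmul assms finite)

text \<open>Convergence of \<open>C z * z\<close> means at most a simple pole, whose residue is the
  limit.\<close>

lemma has_contour_integral_circlepath_residue:
  assumes C: "C holomorphic_on ball 0 1 - {0}" and lim: "((\<lambda>z. C z * z) \<longlongrightarrow> c) (at 0)"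
    and r: "0 < r" "r < 1"
  shows "(C has_contour_integral 2 * pi * \<i> * c) (circlepath 0 r)"
proof -
  have "residue C 0 = c"
    using residue_simple'[OF open_ball _ C, of c] lim by simp
  then show ?thesis
    using base_residue[OF open_ball _ r(1) C] r by (auto simp: subset_iff)
qed

section \<open>Normalisation by isometries, and the theorem\<close>

text \<open>Both functions have the same set of derivatives at each point, so the values of
  \<open>deriv\<close> agree even where neither is differentiable.\<close>

lemma deriv_diff_const: "deriv (\<lambda>z. g z - c) = deriv g"
proof -
  have "((\<lambda>z. g z - c) has_field_derivative D) (at x) \<longleftrightarrow> (g has_field_derivative D) (at x)" for D x
    using DERIV_diff[of g D x UNIV "\<lambda>_. c" 0] DERIV_add[of "\<lambda>z. g z - c" D x UNIV "\<lambda>_. c" 0] by auto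
  then show ?thesis
    by (simp add: deriv_def fun_eq_iff)
qed

lemma const_near_0_diff_const: "const_near_0 (\<lambda>z. g z - c) \<longleftrightarrow> const_near_0 g"
proof
  assume "const_near_0 (\<lambda>z. g z - c)"
  then obtain b where "\<forall>\<^sub>F z in at 0. g z - c = b" by (auto simp: const_near_0_def)
  then have "\<forall>\<^sub>F z in at 0. g z = b + c" by eventually_elim (simp add: algebra_simps)
  then show "const_near_0 g" by (auto simp: const_near_0_def)
next
  assume "const_near_0 g"
  then obtain b where "\<forall>\<^sub>F z in at 0. g z = b" by (auto simp: const_near_0_def)
  then have "\<forall>\<^sub>F z in at 0. g z - c = b - c" by eventually_elim simp
  then show "const_near_0 (\<lambda>z. g z - c)" unfolding const_near_0_def by blast
qed

lemma flat_front_lift_mult_left: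
  assumes E: "flat_front_lift E" and w: "w \<in> LH" and a: "det a = 1"
  shows "MC (\<lambda>w. a ** E w) w = MC E w"
    "log_mderiv (\<lambda>w. a ** E w) w = a ** log_mderiv E w ** matrix_inv a"
proof -
  have "(\<lambda>w. E w $ i $ j) field_differentiable at w" for i j
    using E w open_LH holomorphic_on_imp_differentiable_at unfolding flat_front_lift_def by blast
  then show "MC (\<lambda>w. a ** E w) w = MC E w"
    "log_mderiv (\<lambda>w. a ** E w) w = a ** log_mderiv E w ** matrix_inv a"
    using E w a by (auto intro!: MC_mult_left log_mderiv_mult_left simp: flat_front_lift_def)
qed

text \<open>The metric depends on the lift only through \<open>MC\<close>, and the curves stay in
  \<open>LH\<close>.\<close>

lemma complete_at_0_cong:
  assumes E: "complete_at_0 E" and eq: "\<And>w. w \<in> LH \<Longrightarrow> MC F w = MC E w"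
  shows "complete_at_0 F"
  unfolding complete_at_0_def
proof (intro allI impI)
  fix \<gamma> :: "real \<Rightarrow> complex"
  assume \<gamma>: "\<gamma> ` {0..<1} \<subseteq> LH" "\<forall>b\<in>{0..<1}. \<gamma> piecewise_C1_differentiable_on {0..b}"
    "filterlim (\<lambda>s. Re (\<gamma> s)) at_bot (at_left 1)"
  have "(\<integral>\<^sup>+ s\<in>{0..<1}. ennreal (rho_w F (\<gamma> s) * norm (vector_derivative \<gamma> (at s))) \<partial>lborel)
      = (\<integral>\<^sup>+ s\<in>{0..<1}. ennreal (rho_w E (\<gamma> s) * norm (vector_derivative \<gamma> (at s))) \<partial>lborel)"
    using \<gamma>(1) by (intro nn_integral_cong)
      (auto simp: rho_w_def om_w_def th_w_def eq image_subset_iff indicator_def)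
  with E \<gamma> show "(\<integral>\<^sup>+ s\<in>{0..<1}. ennreal (rho_w F (\<gamma> s) * norm (vector_derivative \<gamma> (at s))) \<partial>lborel) = \<infinity>"
    unfolding complete_at_0_def by simp
qed

text \<open>Poles are isolated, so a smaller punctured disc contains none. There the pole clause of
  \<open>gauss_map_rep\<close> is excluded and the denominator cannot vanish.\<close>

lemma gauss_map_repD:
  assumes "gauss_map_rep E k g"
  obtains e where "0 < e" "e \<le> 1" "g holomorphic_on ball 0 e - {0}"
    "\<And>w. cmod (exp w) < e \<Longrightarrow> E w $ 2 $ k \<noteq> 0 \<and> g (exp w) = E w $ 1 $ k / E w $ 2 $ k"
    "not_essential g 0"
proof -
  obtain e1 where e1: "0 < e1" "e1 \<le> 1" "g meromorphic_on ball 0 e1"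
    and E: "\<And>w. w \<in> LH \<Longrightarrow> exp w \<in> ball 0 e1 \<Longrightarrow>
       (E w $ 2 $ k \<noteq> 0 \<longrightarrow> g (exp w) = E w $ 1 $ k / E w $ 2 $ k) \<and> (E w $ 2 $ k = 0 \<longrightarrow> is_pole g (exp w))"
    using assms unfolding gauss_map_rep_def by blast
  have m0: "g meromorphic_on {0}"
    using e1 by (auto intro: meromorphic_on_subset)
  then obtain e2 where e2: "e2 > 0" "g analytic_on ball 0 e2 - {0}"
    using meromorphic_on_isolated_singularity unfolding isolated_singularity_at_def by blast
  show thesis
  proof (rule that[of "min e1 e2"])
    show "g holomorphic_on ball 0 (min e1 e2) - {0}"
      using analytic_imp_holomorphic[OF e2(2)] by (rule holomorphic_on_subset) auto
    fix w assume w: "cmod (exp w) < min e1 e2"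
    then have "exp w \<in> ball 0 e2 - {0}" by simp
    then have "g analytic_on {exp w}"
      by (intro analytic_on_subset[OF e2(2)]) simp
    then have "\<not> is_pole g (exp w)"
      by (rule analytic_at_imp_no_pole)
    moreover have "w \<in> LH"
      using w e1(2) unfolding exp_in_unit_disc_iff[symmetric] by linarith
    ultimately show "E w $ 2 $ k \<noteq> 0 \<and> g (exp w) = E w $ 1 $ k / E w $ 2 $ k"
      using E[of w] w by auto
  qed (use e1 e2 m0 meromorphic_on_not_essential in auto)
qed

text \<open>The matrix \<open>a\<close> is the isometry that makes the Gauss maps finite at the end.
  The flux and \<open>q\<close> belong to the original \<open>E\<close>; \<open>q\<close> is
  invariant under isometries and the flux is conjugated.\<close>

theorem theorem2p4:
  fixes E :: "complex \<Rightarrow> complex^2^2"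
    and a :: "complex^2^2"
    and G Gs :: "complex \<Rightarrow> complex"
    and m :: int and \<alpha> q :: complex and r :: real
  assumes wcf: "WCF_end E"
    and iso: "det a = 1"
    and regG: "gauss_map_rep (\<lambda>w. a ** E w) 1 G"
    and regGs: "gauss_map_rep (\<lambda>w. a ** E w) 2 Gs"
    and finite0: "\<not> is_pole G 0"
    and mult: "m = multiplicity G Gs"
    and alpha: "is_alpha G Gs \<alpha>"
    and hopf: "hopf_top_coeff E q"
    and r: "0 < r" "r < 1"
  shows "{c. is_eigenvalue (flux (front E) r) c}
           = {2 * of_int m * \<alpha> / (1 - \<alpha>)\<^sup>2, - (2 * of_int m * \<alpha> / (1 - \<alpha>)\<^sup>2)}
       \<and> 2 * of_int m * \<alpha> / (1 - \<alpha>)\<^sup>2 = - (2 * q / of_int m)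
       \<and> (\<alpha> \<noteq> 0 \<longrightarrow> diagonalizable (flux (front E) r))"
proof -
  have E: "flat_front_lift E" and complete: "complete_at_0 E"
    using wcf by (auto simp: WCF_end_def)
  have holE: "(\<lambda>w. E w $ i $ j) holomorphic_on LH" for i j
    using E by (simp add: flat_front_lift_def)
  have detE: "det (E w) = 1" if "w \<in> LH" for w
    using E that by (simp add: flat_front_lift_def)
  obtain e1 where e1: "0 < e1" "e1 \<le> 1" "G holomorphic_on ball 0 e1 - {0}" "not_essential G 0"
    and G: "\<And>w. cmod (exp w) < e1 \<Longrightarrow> (a ** E w) $ 2 $ 1 \<noteq> 0 \<and> G (exp w) = (a ** E w) $ 1 $ 1 / (a ** E w) $ 2 $ 1"
    using gauss_map_repD[OF regG] by metis
  obtain e2 where e2: "0 < e2" "e2 \<le> 1" "Gs holomorphic_on ball 0 e2 - {0}" "not_essential Gs 0"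
    and Gs: "\<And>w. cmod (exp w) < e2 \<Longrightarrow> (a ** E w) $ 2 $ 2 \<noteq> 0 \<and> Gs (exp w) = (a ** E w) $ 1 $ 2 / (a ** E w) $ 2 $ 2"
    using gauss_map_repD[OF regGs] by metis
  obtain c where c: "G \<midarrow>0\<rightarrow> c"
    using e1(4) finite0 by (auto simp: not_essential_def)
  \<comment> \<open>a parabolic isometry moving the common limit \<open>c\<close> of the Gauss maps to \<open>0\<close>\<close>
  define b :: "complex^2^2" where "b = (\<chi> i j. if i = j then 1 else if i = 1 then - c else 0)"
  define P where "P = b ** a"
  define F where "F w = P ** E w" for w
  have detP: "det P = 1"
    using iso by (simp add: P_def det_mul) (simp add: b_def det_2)
  have F_nth: "F w $ 1 $ k = (a ** E w) $ 1 $ k - c * (a ** E w) $ 2 $ k" "F w $ 2 $ k = (a ** E w) $ 2 $ k" for w k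
  proof -
    have b_mult: "(b ** X) $ 1 $ k = X $ 1 $ k - c * X $ 2 $ k" "(b ** X) $ 2 $ k = X $ 2 $ k" for X :: "complex^2^2"
      by (simp_all add: b_def matrix_matrix_mult_def sum_2)
    have "F w = b ** (a ** E w)"
      by (simp add: F_def P_def matrix_mul_assoc)
    then show "F w $ 1 $ k = (a ** E w) $ 1 $ k - c * (a ** E w) $ 2 $ k" "F w $ 2 $ k = (a ** E w) $ 2 $ k"
      by (simp_all only: b_mult)
  qed
  have MC: "MC F w = MC E w" and log_mderiv: "log_mderiv F w = P ** log_mderiv E w ** matrix_inv P" if "w \<in> LH" for w
    unfolding F_def[abs_def] by (rule flat_front_lift_mult_left[OF E that detP])+
  interpret gauss_chart F "\<lambda>z. G z - c" "\<lambda>z. Gs z - c" "min e1 e2"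
  proof
    show "(\<lambda>w. F w $ i $ j) holomorphic_on LH" for i j
      unfolding F_def matrix_matrix_mult_def by (auto intro!: holomorphic_intros holE)
    show "det (F w) = 1" if "w \<in> LH" for w
      using detE[OF that] detP by (simp add: F_def det_mul)
    show "MC F w $ 1 $ 1 = 0" "MC F w $ 2 $ 2 = 0" if "w \<in> LH" for w
      using E that by (auto simp: MC flat_front_lift_def)
    show "(\<lambda>z. G z - c) holomorphic_on ball 0 (min e1 e2) - {0}"
      by (intro holomorphic_intros holomorphic_on_subset[OF e1(3)]) auto
    show "(\<lambda>z. Gs z - c) holomorphic_on ball 0 (min e1 e2) - {0}"
      by (intro holomorphic_intros holomorphic_on_subset[OF e2(3)]) auto
    fix w assume "cmod (exp w) < min e1 e2"
    then show "F w $ 2 $ 1 \<noteq> 0" "F w $ 2 $ 2 \<noteq> 0"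
      "G (exp w) - c = F w $ 1 $ 1 / F w $ 2 $ 1" "Gs (exp w) - c = F w $ 1 $ 2 / F w $ 2 $ 2"
      using G[of w] Gs[of w] by (auto simp: F_nth diff_divide_distrib)
  qed (use e1 e2 in auto)
  have mult': "multiplicity (\<lambda>z. G z - c) (\<lambda>z. Gs z - c) = m"
    by (simp add: mult multiplicity_def deriv_diff_const const_near_0_diff_const)
  have alpha': "is_alpha (\<lambda>z. G z - c) (\<lambda>z. Gs z - c) \<alpha>"
    using alpha by (simp add: is_alpha_def deriv_diff_const)
  have hopf': "hopf_top_coeff F q"
    unfolding hopf_top_coeff_def
  proof (intro allI impI)
    fix \<epsilon> :: real assume "\<epsilon> > 0"
    then obtain R where R: "R < 0" "\<And>w. Re w < R \<Longrightarrow> cmod (om_w E w * th_w E w - q) < \<epsilon>"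
      using hopf unfolding hopf_top_coeff_def by blast
    have "cmod (om_w F w * th_w F w - q) < \<epsilon>" if "Re w < R" for w
      using R(2)[OF that] R(1) that by (simp add: om_w_def th_w_def MC LH_def)
    with R(1) show "\<exists>R<0. \<forall>w. Re w < R \<longrightarrow> cmod (om_w F w * th_w F w - q) < \<epsilon>" by blast
  qed
  define \<mu> where "\<mu> = 2 * of_int m * \<alpha> / (1 - \<alpha>)\<^sup>2"
  have "(\<lambda>z. G z - c) \<midarrow>0\<rightarrow> 0"
    using tendsto_diff[OF c tendsto_const[of c]] by simp
  moreover have "not_essential (\<lambda>z. Gs z - c) 0"
  proof -
    have "isolated_singularity_at Gs 0"
      using isolated_singularity_at_holomorphic[OF e2(3)] e2(1) by simp
    then have "Gs meromorphic_on {0}"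
      using e2(4) by (simp add: meromorphic_at_iff)
    then have "(\<lambda>z. Gs z - c) meromorphic_on {0}"
      by (intro meromorphic_intros)
    then show ?thesis
      by (rule meromorphic_on_not_essential)
  qed
  ultimately have asym: "m > 0" "\<alpha> \<noteq> 1" "\<mu> = - (2 * q / of_int m)"
    "((\<lambda>z. log_mderiv F (Ln z) $ 1 $ 1) \<longlongrightarrow> - \<mu>) (at 0)"
    "((\<lambda>z. log_mderiv F (Ln z) $ 1 $ 2) \<longlongrightarrow> 0) (at 0)"
    using end_asymptotics[OF complete_at_0_cong[OF complete MC] _ _ alpha' hopf'] unfolding mult' \<mu>_def by auto
  define A where "A z = wirtinger (front E) z ** matrix_inv (front E z)" for z
  \<comment> \<open>The flux form of the normalised front, obtained by conjugation; multiplied by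
    \<open>z\<close> it is \<open>log_mderiv F\<close>, because \<open>dw = dz / z\<close>.\<close>
  define C where "C z = P ** A z ** matrix_inv P" for z
  have A_exp: "A (exp w) $ i $ j = log_mderiv E w $ i $ j / exp w" if "w \<in> LH" for w i j
    unfolding A_def by (rule wirtinger_front_mult_inv[OF E that])
  have C_Ln: "C z $ i $ j * z = log_mderiv F (Ln z) $ i $ j" if "z \<in> ball 0 1 - {0}" for z i j
  proof -
    have w: "Ln z \<in> LH" and z: "exp (Ln z) = z"
      using that exp_in_unit_disc_iff[of "Ln z"] by auto
    have "log_mderiv E (Ln z) $ k $ l = z * A z $ k $ l" for k l
      using A_exp[OF w, of k l] that by (simp add: z)
    then show ?thesis
      unfolding C_def log_mderiv[OF w] by (simp add: matrix_matrix_mult_def sum_2 algebra_simps)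
  qed
  have holA: "(\<lambda>z. A z $ i $ j) holomorphic_on ball 0 1 - {0}" for i j
  proof (rule holomorphic_on_punctured_disc_if_lift)
    have dE: "(\<lambda>w. mderiv E w $ i $ j) holomorphic_on LH" for i j
      unfolding mderiv_def using holE open_LH by (simp add: holomorphic_deriv)
    have "\<forall>i j. (\<lambda>w. log_mderiv E w $ i $ j) holomorphic_on LH"
      unfolding forall_2
      by (simp add: log_mderiv_nth[of E, OF detE] holomorphic_intros holE dE cong: holomorphic_cong)
    then show "(\<lambda>w. log_mderiv E w $ i $ j / exp w) holomorphic_on LH"
      by (intro holomorphic_intros) auto
  qed (rule A_exp)
  have holC: "(\<lambda>z. C z $ i $ j) holomorphic_on ball 0 1 - {0}" for i j
    unfolding C_def matrix_matrix_mult_def by (auto intro!: holomorphic_intros holA)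
  have near: "\<forall>\<^sub>F z in at (0::complex). z \<in> ball 0 1 - {0}"
    unfolding eventually_at by (intro exI[of _ 1]) auto
  have C_lim: "((\<lambda>z. C z $ i $ j * z) \<longlongrightarrow> l) (at 0)" if "((\<lambda>z. log_mderiv F (Ln z) $ i $ j) \<longlongrightarrow> l) (at 0)" for i j l
    by (rule Lim_transform_eventually[OF that], rule eventually_mono[OF near], rule C_Ln[symmetric])
  \<comment> \<open>The form is traceless, so the (1,1) limit determines the (2,2) limit.\<close>
  have near': "\<forall>\<^sub>F z in at 0. - log_mderiv F (Ln z) $ 1 $ 1 = log_mderiv F (Ln z) $ 2 $ 2"
  proof -
    have "\<forall>\<^sub>F z in at (0::complex). z \<in> ball 0 (min e1 e2) - {0}"
      using e unfolding eventually_at by (intro exI[of _ "min e1 e2"]) auto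
    then show ?thesis
      by eventually_elim (rule log_mderiv_eqs(3)[OF _ refl, symmetric], auto)
  qed
  from Lim_transform_eventually[OF tendsto_minus[OF asym(4)] near']
  have lim22: "((\<lambda>z. log_mderiv F (Ln z) $ 2 $ 2) \<longlongrightarrow> \<mu>) (at 0)"
    by simp
  define J :: "complex^2^2" where "J = (\<chi> i j. contour_integral (circlepath 0 r) (\<lambda>z. A z $ i $ j))"
  have J: "((\<lambda>z. A z $ i $ j) has_contour_integral J $ i $ j) (circlepath 0 r)" for i j
    unfolding J_def vec_lambda_beta
    using contour_integral_circlepath_eq(1)[OF open_ball holA r(1) order_refl] r
    by (intro has_contour_integral_integral) (auto simp: subset_iff)
  define M where "M = P ** J ** matrix_inv P"
  have M: "M $ i $ j = 2 * pi * \<i> * l" if "((\<lambda>z. log_mderiv F (Ln z) $ i $ j) \<longlongrightarrow> l) (at 0)" for i j l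
    \<comment> \<open>Two evaluations of one integral: conjugating the integral of \<open>A\<close>,
      and taking the residue of an entry of \<open>C\<close>.\<close>
    by (rule has_contour_integral_unique[OF
          has_contour_integral_conjugate[OF J, of P "matrix_inv P" i j, folded M_def C_def]
          has_contour_integral_circlepath_residue[OF holC C_lim[OF that] r]])
  have flux: "flux (front E) r $ i $ j = \<i> / (2 * pi) * J $ i $ j" for i j
    by (simp add: flux_def J_def A_def)
  have "det J = det M"
  proof -
    have "det P * det (matrix_inv P) = 1"
      using arg_cong[OF matrix_inv_2_mult(1)[OF detP], of det] by (simp add: det_mul det_I)
    then show ?thesis
      using detP by (simp add: M_def det_mul)
  qed
  \<comment> \<open>The unknown entry \<open>M $ 2 $ 1\<close> is multiplied by
    \<open>M $ 1 $ 2 = 0\<close>, so the determinant is the product of the diagonal entries.\<close>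
  also have "\<dots> = (2 * pi * \<mu>)\<^sup>2"
    by (simp add: det_2 M[OF asym(4)] M[OF asym(5)] M[OF lim22] power2_eq_square algebra_simps)
  finally have detJ: "det J = (2 * pi * \<mu>)\<^sup>2" .
  have "det (flux (front E) r) = (\<i> / (2 * pi))\<^sup>2 * det J"
    by (simp add: det_2 flux power2_eq_square algebra_simps)
  then have det_flux: "det (flux (front E) r) = - \<mu>\<^sup>2"
    by (simp add: detJ power2_eq_square)
  have "J $ 1 $ 1 + J $ 2 $ 2 = M $ 1 $ 1 + M $ 2 $ 2"
    using detP unfolding M_def by (simp add: matrix_matrix_mult_def sum_2 matrix_inv_2[OF detP] det_2) algebra
  also have "\<dots> = 0"
    by (simp add: M[OF asym(4)] M[OF lim22])
  finally have tr: "flux (front E) r $ 1 $ 1 + flux (front E) r $ 2 $ 2 = 0"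
    unfolding flux distrib_left[symmetric] by simp
  have "\<mu> \<noteq> 0" if "\<alpha> \<noteq> 0"
    using that asym(1,2) by (simp add: \<mu>_def)
  then have "diagonalizable (flux (front E) r)" if "\<alpha> \<noteq> 0"
    using diagonalizable_trace_0[OF tr det_flux] that by blast
  moreover have "{c. is_eigenvalue (flux (front E) r) c} = {\<mu>, - \<mu>}"
    using is_eigenvalue_trace_0_iff[OF tr det_flux] by auto
  ultimately show ?thesis
    using asym(3) unfolding \<mu>_def by blast
qed

end
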